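(* Let $T\in\mathcal T_h^\Gamma$. The basis functions $(\boldsymbol\phi_{k,T}^\Gamma,\varphi_{k,T}^\Gamma)$, $k=1,\dots,(N+1)^2$, of $\widetilde{\boldsymbol P_1P_1}(T)$ determined by $\mathrm{DoF}_{l,T}(\boldsymbol\phi_{k,T}^\Gamma,\varphi_{k,T}^\Gamma)=\delta_{kl}$ for all $k,l=1,\dots,(N+1)^2$ are given explicitly by $$\boldsymbol\phi_{k,T}^\Gamma=\begin{cases}\displaystyle\boldsymbol\phi_{k,T}+\sum_{i=1}^{N-1}\frac{\mathbf t_{i,h}^T\sigma(\mu^-/\mu^+-1,\boldsymbol\phi_{k,T},0)\mathbf n_h}{1+(\mu^-/\mu^+-1)\nabla I_{h,T}w_T\cdot\mathbf n_h}(w_T-I_{h,T}w_T)\mathbf t_{i,h},&k=1,\dots,N(N+1),\\ \mathbf 0,&k=N(N+1)+1,\dots,(N+1)^2,\end{cases}$$ $$\varphi_{k,T}^\Gamma=\begin{cases}\mathbf n_h^T\sigma(\mu^--\mu^+,\boldsymbol\phi_{k,T},0)\mathbf n_h\,(z_T-I_{h,T}z_T),&k=1,\dots,N(N+1),\\ \varphi_{k,T},&k=N(N+1)+1,\dots,(N+1)^2,\end{cases}$$ where $(\boldsymbol\phi_{k,T},\varphi_{k,T})$ are the standard basis functions of $(P_1(T)^N,P_1(T))$ with $\mathrm{DoF}_{l,T}(\boldsymbol\phi_{k,T},\varphi_{k,T})=\delta_{kl}$.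
   Context: Setting. $N\in\{2,3\}$; $\Omega\subset\mathbb R^N$ is an open rectangle ($N=2$) or cuboid ($N=3$); $\Gamma\subset\Omega$ is a closed $C^2$ hypersurface dividing $\Omega$ into $\Omega^-$ (the inclusion, $\partial\Omega^-=\Gamma$) and $\Omega^+$; $\mu^\pm>0$ are constants. $d$ is the signed distance, $d=\pm\mathrm{dist}(\cdot,\Gamma)$ in $\Omega^\pm$. $\{\mathcal T_h\}$ is a shape-regular family of Cartesian simplicial meshes of $\Omega$, not fitted to $\Gamma$: $\Omega$ is divided into rectangles/cuboids by a tensor-product grid; for $N=2$ each rectangle is split into two triangles by a diagonal, for $N=3$ each cuboid is split into six tetrahedra sharing a space diagonal (Kuhn subdivision), in the same manner in every cell. Elements are open; $\mathcal T_h^\Gamma=\{T\in\mathcal T_h:T\cap\Gamma\neq\emptyset\}$; $h=\max_T\mathrm{diam}(T)$ is smaller than a fixed threshold (so that the interface is resolved). $I_h$ is continuous piecewise linear nodal interpolation, $I_{h,T}$ linear nodal interpolation on $T$. $\Gamma_h=\{I_hd=0\}$, $\Omega_h^\pm=\{\pm I_hd>0\}$, $T_h^\pm=T\cap\Omega_h^\pm$, $\mu_h|_{\Omega_h^\pm}=\mu^\pm$. For $T\in\mathcal T_h^\Gamma$: $\Gamma_{h,T}=\Gamma_h\cap T$ (assumed nonempty), $\Gamma_{h,T}^{ext}$ is the hyperplane containing it, $\mathbf n_h$ is the unit normal to it pointing from $\Omega_h^-$ to $\Omega_h^+$, $\mathbf t_{1,h},\dots,\mathbf t_{N-1,h}$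 are unit tangent vectors forming with $\mathbf n_h$ an orthonormal basis, $\mathbf x_T^*$ is a fixed point of $\Gamma_{h,T}$, $\mathbf a_{1,T},\dots,\mathbf a_{N+1,T}$ are the vertices of $T$; $[v]_{\Gamma_{h,T}}$ is the value from $\Omega_h^+$ minus that from $\Omega_h^-$. Vertex values of functions discontinuous across $\Gamma_h$ at a vertex on $\Gamma_h$ are taken from the minus side. $\boldsymbol\epsilon(\mathbf v)=\frac12(\nabla\mathbf v+(\nabla\mathbf v)^T)$, $\sigma(\mu,\mathbf v,q)=2\mu\boldsymbol\epsilon(\mathbf v)-q\mathbb I$ (for any real $\mu$). $P_1(\cup T_h^\pm)$ is the set of functions on $T$ whose restrictions to $T_h^+$ and $T_h^-$ are polynomials of degree $\le1$, $\boldsymbol P_1(\cup T_h^\pm)=P_1(\cup T_h^\pm)^N$. $\widetilde{\boldsymbol P_1P_1}(T)$ is the set of $(\mathbf v,q)\in(\boldsymbol P_1(\cup T_h^\pm),P_1(\cup T_h^\pm))$ with $[\sigma(\mu_h,\mathbf v,q)\mathbf n_h]_{\Gamma_{h,T}}(\mathbf x_T^* )=\mathbf 0$, $[\mathbf v]_{\Gamma_{h,T}}=\mathbf 0$, $[\nabla\cdot\mathbf v]_{\Gamma_{h,T}}=0$, $[\nabla q]_{\Gamma_{h,T}}=\mathbf 0$. Degrees of freedom, with $\mathbf v=(v_1,\dots,v_N)^T$: $\mathrm{DoF}_{j+(i-1)(N+1),T}(\mathbf v,q)=v_i(\mathbf a_{j,T})$ and $\mathrm{DoF}_{(N+1)N+j,T}(\mathbf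 v,q)=q(\mathbf a_{j,T})$ for $j=1,\dots,N+1$, $i=1,\dots,N$. The functions $z_T,w_T$ on $T$: $z_T=-1$ on $T_h^+$, $z_T=0$ on $T_h^-$; $w_T(\mathbf x)=\mathrm{dist}(\mathbf x,\Gamma_{h,T}^{ext})$ on $T_h^+$, $w_T=0$ on $T_h^-$. *)

theory Defs
  imports "HOL-Analysis.Analysis"
begin

section \<open>Differential operators\<close>

definition grad :: "('a::real_inner \<Rightarrow> real) \<Rightarrow> 'a \<Rightarrow> 'a" where
  "grad f x = (THE D. GDERIV f x :> D)"

definition divergence :: "(real^'n \<Rightarrow> real^'n) \<Rightarrow> real^'n \<Rightarrow> real" where
  "divergence v x = trace (jacobian v (at x))"

definition strain :: "(real^'n \<Rightarrow> real^'n) \<Rightarrow> real^'n \<Rightarrow> real^'n^'n" where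
  "strain v x = (1/2) *\<^sub>R (jacobian v (at x) + transpose (jacobian v (at x)))"

definition stress :: "real \<Rightarrow> (real^'n \<Rightarrow> real^'n) \<Rightarrow> (real^'n \<Rightarrow> real) \<Rightarrow> real^'n \<Rightarrow> real^'n^'n" where
  "stress \<mu> v q x = (2 * \<mu>) *\<^sub>R strain v x - q x *\<^sub>R mat 1"

section \<open>The interface\<close>

definition C2_on :: "(real^'n) set \<Rightarrow> (real^'n \<Rightarrow> real) \<Rightarrow> bool" where
  "C2_on U f \<longleftrightarrow> (\<exists>G H. (\<forall>x\<in>U. GDERIV f x :> G x \<and> (G has_derivative (\<lambda>v. H x *v v)) (at x))
                      \<and> continuous_on U (H :: real^'n \<Rightarrow> real^'n^'n))"

definition closed_C2_hypersurface :: "(real^'n) set \<Rightarrow> bool" where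
  "closed_C2_hypersurface \<Gamma> \<longleftrightarrow> compact \<Gamma> \<and>
     (\<forall>x\<in>\<Gamma>. \<exists>U f. open U \<and> x \<in> U \<and> C2_on U f \<and> (\<forall>y\<in>U. grad f y \<noteq> 0)
                  \<and> \<Gamma> \<inter> U = {y\<in>U. f y = 0})"

definition interface_divides ::
  "(real^'n) set \<Rightarrow> (real^'n) set \<Rightarrow> (real^'n) set \<Rightarrow> (real^'n) set \<Rightarrow> bool" where
  "interface_divides \<Omega> \<Gamma> \<Omega>m \<Omega>p \<longleftrightarrow>
     \<Gamma> \<subseteq> \<Omega> \<and> open \<Omega>m \<and> open \<Omega>p \<and> \<Omega>m \<noteq> {} \<and> \<Omega>p \<noteq> {} \<and> \<Omega>m \<inter> \<Omega>p = {} \<and>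
     \<Omega>m \<union> \<Omega>p = \<Omega> - \<Gamma> \<and> frontier \<Omega>m = \<Gamma>"

(* The plus sign is used everywhere off \<Omega>m, which also covers mesh nodes on the boundary of \<Omega>. *)
definition signed_dist :: "(real^'n) set \<Rightarrow> (real^'n) set \<Rightarrow> real^'n \<Rightarrow> real" where
  "signed_dist \<Gamma> \<Omega>m x = (if x \<in> \<Omega>m then - infdist x \<Gamma> else infdist x \<Gamma>)"

section \<open>Cartesian simplicial meshes\<close>

text \<open>
  A tensor-product grid has grid points \<open>g i 0 < \<dots> < g i (m i)\<close> in direction \<open>i\<close>; the cell with
  multi-index \<open>c\<close> is the product of the intervals from \<open>g i (c i)\<close> to \<open>g i (Suc (c i))\<close>.  The set
  \<open>S\<close> of coordinates fixes the space diagonal: it starts at the cell vertex having the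
  upper grid value exactly in the coordinates in \<open>S\<close> and ends at the opposite one.
  Each ordering \<open>p\<close> of the coordinates gives the Kuhn simplex whose vertices are passed when
  walking along cell edges from the start to the end of the diagonal, changing the coordinates
  \<open>p 1, p 2, \<dots>\<close> in turn.  In two dimensions these are the two triangles cut off
  by a diagonal, in three dimensions the six tetrahedra sharing a space diagonal.
\<close>

definition cell_vertex ::
  "('n \<Rightarrow> nat \<Rightarrow> real) \<Rightarrow> 'n set \<Rightarrow> ('n \<Rightarrow> nat) \<Rightarrow> 'n set \<Rightarrow> real^'n" where
  "cell_vertex g S c A = (\<chi> i. if (i \<in> A) \<noteq> (i \<in> S) then g i (Suc (c i)) else g i (c i))"

definition kuhn_simplex ::
  "('n \<Rightarrow> nat \<Rightarrow> real) \<Rightarrow> 'n set \<Rightarrow> ('n \<Rightarrow> nat) \<Rightarrow> (nat \<Rightarrow> 'n) \<Rightarrow> (real^'n) set" where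
  "kuhn_simplex g S c p =
     interior (convex hull ((\<lambda>j. cell_vertex g S c (p ` {1..j})) ` {0..CARD('n)}))"

definition cartesian_mesh :: "real^'n \<Rightarrow> real^'n \<Rightarrow> (real^'n) set set \<Rightarrow> bool" where
  "cartesian_mesh lo hi M \<longleftrightarrow>
     (\<exists>m g S. (\<forall>i. 0 < m i \<and> g i 0 = lo $ i \<and> g i (m i) = hi $ i \<and> strict_mono_on {0..m i} (g i))
        \<and> M = {kuhn_simplex g S c p | c p. (\<forall>i. c i < m i) \<and> bij_betw p {1..CARD('n)} UNIV})"

definition mesh_size :: "(real^'n) set set \<Rightarrow> real" where
  "mesh_size M = Max (diameter ` M)"

definition shape_regular :: "(real^'n) set set set \<Rightarrow> bool" where
  "shape_regular F \<longleftrightarrow> (\<exists>\<kappa>>0. \<forall>M\<in>F. \<forall>T\<in>M. \<exists>x r. ball x r \<subseteq> T \<and> diameter T \<le> \<kappa> * r)"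

definition vertices :: "(real^'n) set \<Rightarrow> (real^'n) set" where
  "vertices T = {x. x extreme_point_of closure T}"

section \<open>Linear interpolation and the discrete interface\<close>

definition P1 :: "(real^'n \<Rightarrow> real) \<Rightarrow> bool" where
  "P1 p \<longleftrightarrow> (\<exists>b w. \<forall>x. p x = b + w \<bullet> x)"

definition P1_interp :: "(real^'n) set \<Rightarrow> (real^'n \<Rightarrow> real) \<Rightarrow> real^'n \<Rightarrow> real" where
  "P1_interp T u = (THE p. P1 p \<and> (\<forall>a\<in>vertices T. p a = u a))"

definition mesh_interp :: "(real^'n) set set \<Rightarrow> (real^'n \<Rightarrow> real) \<Rightarrow> real^'n \<Rightarrow> real" where
  "mesh_interp M u x = (THE y. \<forall>T\<in>M. x \<in> closure T \<longrightarrow> P1_interp T u x = y)"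

definition Gamma_h :: "(real^'n) set \<Rightarrow> (real^'n) set set \<Rightarrow> (real^'n \<Rightarrow> real) \<Rightarrow> (real^'n) set" where
  "Gamma_h \<Omega> M d = {x\<in>\<Omega>. mesh_interp M d x = 0}"

definition Omega_h_plus :: "(real^'n) set \<Rightarrow> (real^'n) set set \<Rightarrow> (real^'n \<Rightarrow> real) \<Rightarrow> (real^'n) set" where
  "Omega_h_plus \<Omega> M d = {x\<in>\<Omega>. mesh_interp M d x > 0}"

definition Omega_h_minus :: "(real^'n) set \<Rightarrow> (real^'n) set set \<Rightarrow> (real^'n \<Rightarrow> real) \<Rightarrow> (real^'n) set" where
  "Omega_h_minus \<Omega> M d = {x\<in>\<Omega>. - mesh_interp M d x > 0}"

definition interface_elements :: "(real^'n) set set \<Rightarrow> (real^'n) set \<Rightarrow> (real^'n) set set" where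
  "interface_elements M \<Gamma> = {T\<in>M. T \<inter> \<Gamma> \<noteq> {}}"

definition hyperplane :: "(real^'n) set \<Rightarrow> bool" where
  "hyperplane H \<longleftrightarrow> (\<exists>c b. c \<noteq> 0 \<and> H = {x. c \<bullet> x = b})"

(* Fails on T only in the degenerate case that the interpolant of d vanishes on all of T. *)
definition interface_resolved ::
  "(real^'n) set \<Rightarrow> (real^'n) set \<Rightarrow> (real^'n \<Rightarrow> real) \<Rightarrow> (real^'n) set set \<Rightarrow> bool" where
  "interface_resolved \<Omega> \<Gamma> d M \<longleftrightarrow>
     (\<forall>T\<in>interface_elements M \<Gamma>. \<exists>H. hyperplane H \<and> Gamma_h \<Omega> M d \<inter> T \<subseteq> H)"

text \<open>
  \<open>n\<close> is the unit normal to the hyperplane \<open>H\<close> pointing from \<open>Tm\<close> to \<open>Tp\<close>, and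
  \<open>t 1, \<dots>, t (N - 1)\<close> complete it to an orthonormal basis.
\<close>

definition interface_frame ::
  "(real^'n) set \<Rightarrow> (real^'n) set \<Rightarrow> (real^'n) set \<Rightarrow> real^'n \<Rightarrow> (nat \<Rightarrow> real^'n) \<Rightarrow> bool" where
  "interface_frame H Tp Tm n t \<longleftrightarrow>
     norm n = 1 \<and> (\<forall>x\<in>H. \<forall>y\<in>H. n \<bullet> (x - y) = 0) \<and>
     (\<forall>y\<in>H. (\<forall>x\<in>Tp. n \<bullet> (x - y) > 0) \<and> (\<forall>x\<in>Tm. n \<bullet> (x - y) < 0)) \<and>
     (\<forall>i\<in>{1..CARD('n) - 1}. t i \<bullet> n = 0 \<and>
        (\<forall>j\<in>{1..CARD('n) - 1}. t i \<bullet> t j = (if i = j then 1 else 0)))"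

section \<open>Broken linear functions\<close>

text \<open>
  Functions in the broken spaces are considered on \<open>Tp \<union> Tm\<close> only; their values elsewhere are
  immaterial.  Traces on the interface and at vertices of a function that is linear on the
  nonempty open set \<open>A\<close> are those of its unique linear extension from \<open>A\<close>.
\<close>

definition P1_ext :: "(real^'n) set \<Rightarrow> (real^'n \<Rightarrow> real) \<Rightarrow> real^'n \<Rightarrow> real" where
  "P1_ext A f = (THE p. P1 p \<and> (\<forall>x\<in>A. f x = p x))"

definition P1_ext_vec :: "(real^'n) set \<Rightarrow> (real^'n \<Rightarrow> real^'n) \<Rightarrow> real^'n \<Rightarrow> real^'n" where
  "P1_ext_vec A v x = (\<chi> i. P1_ext A (\<lambda>y. v y $ i) x)"

definition broken_P1 :: "(real^'n) set \<Rightarrow> (real^'n) set \<Rightarrow> (real^'n \<Rightarrow> real) \<Rightarrow> bool" where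
  "broken_P1 Tp Tm f \<longleftrightarrow>
     (\<exists>p. P1 p \<and> (\<forall>x\<in>Tp. f x = p x)) \<and> (\<exists>p. P1 p \<and> (\<forall>x\<in>Tm. f x = p x))"

(* As d agrees with its nodal interpolant at the vertices, a vertex a lies on the discrete
   interface iff d a = 0; there the value is taken from the minus side. *)
definition vertex_value ::
  "(real^'n \<Rightarrow> real) \<Rightarrow> (real^'n) set \<Rightarrow> (real^'n) set \<Rightarrow> (real^'n \<Rightarrow> real) \<Rightarrow> real^'n \<Rightarrow> real" where
  "vertex_value d Tp Tm f a = (if d a > 0 then P1_ext Tp f a else P1_ext Tm f a)"

definition broken_interp ::
  "(real^'n \<Rightarrow> real) \<Rightarrow> (real^'n) set \<Rightarrow> (real^'n) set \<Rightarrow> (real^'n) set \<Rightarrow>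
   (real^'n \<Rightarrow> real) \<Rightarrow> real^'n \<Rightarrow> real" where
  "broken_interp d Tp Tm T f = P1_interp T (vertex_value d Tp Tm f)"

definition ife_space ::
  "real \<Rightarrow> real \<Rightarrow> (real^'n) set \<Rightarrow> (real^'n) set \<Rightarrow> (real^'n) set \<Rightarrow> real^'n \<Rightarrow> real^'n \<Rightarrow>
   ((real^'n \<Rightarrow> real^'n) \<times> (real^'n \<Rightarrow> real)) set" where
  "ife_space \<mu>p \<mu>m Tp Tm \<Gamma>hT xs n =
     {(v, q). (\<forall>i. broken_P1 Tp Tm (\<lambda>x. v x $ i)) \<and> broken_P1 Tp Tm q \<and>
       stress \<mu>p (P1_ext_vec Tp v) (P1_ext Tp q) xs *v n
         - stress \<mu>m (P1_ext_vec Tm v) (P1_ext Tm q) xs *v n = 0 \<and>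
       (\<forall>x\<in>\<Gamma>hT. P1_ext_vec Tp v x - P1_ext_vec Tm v x = 0) \<and>
       (\<forall>x\<in>\<Gamma>hT. divergence (P1_ext_vec Tp v) x - divergence (P1_ext_vec Tm v) x = 0) \<and>
       (\<forall>x\<in>\<Gamma>hT. grad (P1_ext Tp q) x - grad (P1_ext Tm q) x = 0)}"

text \<open>
  Degrees of freedom for coordinates enumerated by \<open>e\<close> and vertices enumerated by \<open>a\<close>:
  \<open>l = j + (i - 1) * (N + 1)\<close> with \<open>1 \<le> j \<le> N + 1\<close> and \<open>1 \<le> i \<le> N\<close> is solved for \<open>i\<close> and \<open>j\<close>.
\<close>

definition dof ::
  "(nat \<Rightarrow> 'n) \<Rightarrow> (nat \<Rightarrow> real^'n) \<Rightarrow> (real^'n \<Rightarrow> real) \<Rightarrow> (real^'n) set \<Rightarrow> (real^'n) set \<Rightarrow> nat \<Rightarrow>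
   (real^'n \<Rightarrow> real^'n) \<times> (real^'n \<Rightarrow> real) \<Rightarrow> real" where
  "dof e a d Tp Tm l = (\<lambda>(v, q).
     let N = CARD('n) in
     if l \<le> N * (N + 1)
     then vertex_value d Tp Tm (\<lambda>x. v x $ e ((l - 1) div (N + 1) + 1)) (a ((l - 1) mod (N + 1) + 1))
     else vertex_value d Tp Tm q (a (l - N * (N + 1))))"

text \<open>
  The \<open>(N + 1)\<^sup>2\<close> pairs \<open>(\<Phi> k, \<Psi> k)\<close> form the basis of \<open>V\<close>, a space of pairs of
  functions on \<open>A\<close>, that is dual to the functionals \<open>D\<close>.  Linear independence follows from
  duality, and duality forces the coefficients in the expansion.
\<close>

definition dual_basis ::
  "((real^'n \<Rightarrow> real^'n) \<times> (real^'n \<Rightarrow> real)) set \<Rightarrow> (real^'n) set \<Rightarrow>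
   (nat \<Rightarrow> (real^'n \<Rightarrow> real^'n) \<times> (real^'n \<Rightarrow> real) \<Rightarrow> real) \<Rightarrow>
   (nat \<Rightarrow> real^'n \<Rightarrow> real^'n) \<Rightarrow> (nat \<Rightarrow> real^'n \<Rightarrow> real) \<Rightarrow> bool" where
  "dual_basis V A D \<Phi> \<Psi> \<longleftrightarrow>
     (\<forall>k\<in>{1..(CARD('n) + 1)^2}. (\<Phi> k, \<Psi> k) \<in> V) \<and>
     (\<forall>k\<in>{1..(CARD('n) + 1)^2}. \<forall>l\<in>{1..(CARD('n) + 1)^2}.
        D l (\<Phi> k, \<Psi> k) = (if k = l then 1 else 0)) \<and>
     (\<forall>(v, q)\<in>V. \<forall>x\<in>A. v x = (\<Sum>k=1..(CARD('n) + 1)^2. D k (v, q) *\<^sub>R \<Phi> k x) \<and>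
                         q x = (\<Sum>k=1..(CARD('n) + 1)^2. D k (v, q) * \<Psi> k x))"

end

(* A pair in the broken space is an affine pair (b + L x, Q) on the minus side, and on the plus side
   it differs from the extension of that pair by ((n . (x - xs)) c, q0) with c tangential. The stress
   condition, tested with n and with the t_i, determines q0 and c from L. Comparing vertex values
   with the linear interpolants (phi, psi) of the pair gives v = phi + (w - I w) c and
   q = psi - q0 (z - I z). Substituting this in the condition on c yields the scalar equations
   (1 + kappa (grad I w . n)) c_i = t_i . sigma(kappa, phi, 0) n with kappa = mu- / mu+ - 1.
   They are solvable because 0 <= grad I w . n <= 1: a Kuhn simplex has an edge in every coordinate
   direction, I w is the interpolant of the positive part of n . (x - xs), and so each summand of
   grad I w . n lies between 0 and n_i^2. *)
theory Submission
  imports Defs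
begin

section \<open>Affine functions\<close>

text \<open>The claim is an equivalence, so it contains existence and uniqueness of the dual basis.
  Both rest on one operator, \<open>lift_v\<close> with \<open>lift_q\<close>, sending an affine
  pair to the member of the space with the same vertex values; it is linear, so expansions in the
  standard basis carry over.

  Two features of the setting cost work. Traces and interpolants are defined by \<open>THE\<close>,
  so each use needs a set with full affine hull: the vertices, or one of the parts of
  \<open>T\<close>, which are nonempty and open because \<open>xs\<close> is an interior point of
  \<open>T\<close> on the cut. And the discrete interface comes from the interpolant on the whole
  mesh, so an element must be shown to miss the closures of all others before its parts can be
  described by its own interpolant.

  The slope bound is where the shape of the mesh enters. On an obtuse triangle the interpolant of
  the positive part can have negative normal slope, and then the denominator vanishes for some
  viscosity ratio.\<close>

lemma open_step:
  fixes x v :: "'a::real_normed_vector"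
  assumes "open U" "x \<in> U"
  obtains s where "s > 0" "x + s *\<^sub>R v \<in> U"
proof -
  obtain e where e: "e > 0" "ball x e \<subseteq> U"
    using assms open_contains_ball by blast
  define s where "s = (e / 2) / (norm v + 1)"
  have "0 < norm v + 1" by (simp add: add_nonneg_pos)
  then have s: "s > 0" "s * (norm v + 1) = e / 2"
    using e(1) nonzero_eq_divide_eq[THEN iffD1, OF _ s_def] by (simp_all add: s_def)
  then have "s * norm v < e" using e(1) by (simp add: distrib_left)
  then have "x + s *\<^sub>R v \<in> U" using e s(1) by (auto simp: dist_norm subset_iff)
  with s(1) show ?thesis using that by blast
qed

lemma P1I: "p = (\<lambda>x. b + w \<bullet> x) \<Longrightarrow> P1 p"
  unfolding P1_def by blast

lemma P1_const [simp]: "P1 (\<lambda>x. c)"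
  by (rule P1I[of _ c 0]) simp

lemma P1_add: "P1 p \<Longrightarrow> P1 q \<Longrightarrow> P1 (\<lambda>x. p x + q x)"
  unfolding P1_def
  by (metis (no_types, opaque_lifting) add.assoc add.left_commute inner_add_left)

lemma P1_cmult: "P1 p \<Longrightarrow> P1 (\<lambda>x. c * p x)"
  unfolding P1_def by (metis distrib_left inner_scaleR_left)

lemma P1_diff: "P1 p \<Longrightarrow> P1 q \<Longrightarrow> P1 (\<lambda>x. p x - q x)"
  using P1_add[of p "\<lambda>x. -1 * q x"] P1_cmult[of q "-1"] by simp

lemma P1_sum: "(\<And>k. k \<in> K \<Longrightarrow> P1 (p k)) \<Longrightarrow> P1 (\<lambda>x. \<Sum>k\<in>K. c k * p k x)"
  by (induction K rule: infinite_finite_induct) (auto intro!: P1_add P1_cmult)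

lemma P1_inner_diff [simp]: "P1 (\<lambda>x. w \<bullet> (x - y))"
  by (rule P1I[of _ "- (w \<bullet> y)" w]) (simp add: inner_diff_right)

lemma P1_linear:
  fixes L :: "real^'n \<Rightarrow> 'b::euclidean_space"
  assumes "linear L" shows "P1 (\<lambda>x. y \<bullet> L x)"
proof (rule P1I)
  show "(\<lambda>x. y \<bullet> L x) = (\<lambda>x. 0 + adjoint L y \<bullet> x)"
    using adjoint_works[OF assms] by (metis add_0 inner_commute)
qed

text \<open>The spaces are defined componentwise, whereas strain and divergence need one derivative;
  this passes between the two descriptions.\<close>

lemma P1_vec_iff:
  fixes f :: "real^'n \<Rightarrow> real^'n"
  shows "(\<forall>i. P1 (\<lambda>x. f x $ i)) \<longleftrightarrow> (\<exists>b L. linear L \<and> f = (\<lambda>x. b + L x))"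
proof
  assume "\<forall>i. P1 (\<lambda>x. f x $ i)"
  then obtain b w where bw: "\<And>i x. f x $ i = b i + w i \<bullet> x"
    unfolding P1_def by metis
  have "linear (\<lambda>x. \<chi> i. w i \<bullet> x)"
    by (rule linearI) (simp_all add: vec_eq_iff inner_add_right)
  moreover have "f = (\<lambda>x. (\<chi> i. b i) + (\<chi> i. w i \<bullet> x))"
    by (simp add: fun_eq_iff vec_eq_iff bw)
  ultimately show "\<exists>b L. linear L \<and> f = (\<lambda>x. b + L x)"
    by blast
next
  assume "\<exists>b L. linear L \<and> f = (\<lambda>x. b + L x)"
  then obtain b L where L: "linear L" "f = (\<lambda>x. b + L x)" by blast
  have "P1 (\<lambda>x. f x $ i)" for i
    using P1_add[OF P1_const P1_linear[OF L(1), of "axis i 1"], of "b $ i"]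
    by (simp add: L(2) inner_axis')
  then show "\<forall>i. P1 (\<lambda>x. f x $ i)" by blast
qed

text \<open>The set where two affine functions agree is affine, hence contains the hull of
  \<open>A\<close>. The \<open>THE\<close> in \<open>P1_ext\<close> and \<open>P1_interp\<close> is
  resolved through this.\<close>

lemma P1_eq_on_hull:
  assumes "P1 p" "P1 q" "\<forall>x\<in>A. p x = q x" "affine hull A = UNIV"
  shows "p = q"
proof -
  obtain b w where bw: "\<And>x. p x - q x = b + w \<bullet> x"
    using P1_diff[OF assms(1,2)] unfolding P1_def by blast
  have "A \<subseteq> {x. w \<bullet> x = - b}"
    using assms(3) bw by (force simp: algebra_simps)
  then have "affine hull A \<subseteq> {x. w \<bullet> x = - b}"
    by (simp add: affine_hyperplane hull_minimal)
  then have "\<And>x. p x - q x = 0"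
    using bw assms(4) by (simp add: subset_iff)
  then show ?thesis by auto
qed

lemma P1_ext_eq:
  assumes "affine hull A = UNIV" "P1 p" "\<And>x. x \<in> A \<Longrightarrow> f x = p x"
  shows "P1_ext A f = p"
  unfolding P1_ext_def
  using assms by (intro the_equality) (auto intro!: P1_eq_on_hull[of _ p A])

lemma P1_interp_eq:
  assumes "affine hull (vertices T) = UNIV" "P1 p" "\<And>a. a \<in> vertices T \<Longrightarrow> p a = u a"
  shows "P1_interp T u = p"
  unfolding P1_interp_def
  using assms by (intro the_equality) (auto intro!: P1_eq_on_hull[of _ p "vertices T"])

lemma P1_ext_vec_eq:
  fixes v f :: "real^'n \<Rightarrow> real^'n"
  assumes "affine hull A = UNIV" "\<forall>i. P1 (\<lambda>x. f x $ i)" "\<And>x. x \<in> A \<Longrightarrow> v x = f x"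
  shows "P1_ext_vec A v = f"
proof -
  have "P1_ext A (\<lambda>x. v x $ i) = (\<lambda>x. f x $ i)" for i
    using assms by (intro P1_ext_eq) auto
  then show ?thesis by (simp add: fun_eq_iff P1_ext_vec_def vec_eq_iff)
qed

section \<open>Derivatives of affine maps and the stress tensor\<close>

lemma grad_affine [simp]: "grad (\<lambda>x. b + w \<bullet> x) x = w"
  unfolding grad_def
proof (rule the_equality)
  show g: "GDERIV (\<lambda>x. b + w \<bullet> x) x :> w"
    unfolding gderiv_def by (auto intro!: derivative_eq_intros simp: inner_commute)
  fix D assume "GDERIV (\<lambda>x. b + w \<bullet> x) x :> D"
  then have "(\<lambda>h. h \<bullet> D) = (\<lambda>h. h \<bullet> w)"
    using g has_derivative_unique unfolding gderiv_def by blast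
  then show "D = w"
    by (metis inner_commute vector_eq_rdot)
qed

lemma has_derivative_affine:
  fixes L :: "'a::euclidean_space \<Rightarrow> 'b::real_normed_vector"
  assumes "linear L" shows "((\<lambda>x. b + L x) has_derivative L) (at x)"
  using assms
  by (auto intro!: derivative_eq_intros bounded_linear_imp_has_derivative linear_conv_bounded_linear[THEN iffD1])

lemma jacobian_eq:
  assumes "(v has_derivative L) (at x)" shows "jacobian v (at x) = matrix L"
  using frechet_derivative_at[OF assms] by (simp add: jacobian_def)

text \<open>Tested against \<open>y\<close>, the transposed Jacobian becomes \<open>L\<close> with
  the arguments exchanged, and the factor 2 cancels the one half in the strain. Later proofs use the
  stress only in this matrix-free form.\<close>

lemma inner_stress:
  fixes v :: "real^'n \<Rightarrow> real^'n"
  assumes "(v has_derivative L) (at x)"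
  shows "y \<bullet> (stress \<mu> v q x *v u) = \<mu> * (y \<bullet> L u + u \<bullet> L y) - q x * (y \<bullet> u)"
proof -
  have lin: "matrix L *v w = L w" for w
    using assms has_derivative_linear matrix_works linear_matrix_vector_mul_eq by metis
  have "y \<bullet> (transpose (matrix L) *v u) = u \<bullet> (matrix L *v y)"
    by (metis dot_lmul_matrix inner_commute transpose_matrix_vector)
  then show ?thesis
    by (simp add: stress_def strain_def jacobian_eq[OF assms] lin
        matrix_vector_mult_diff_rdistrib matrix_vector_mult_add_rdistrib
        scaleR_matrix_vector_assoc[symmetric] inner_diff_right inner_add_right algebra_simps)
qed

lemma divergence_eq:
  assumes "(v has_derivative L) (at x)"
  shows "divergence v x = (\<Sum>i\<in>UNIV. L (axis i 1) $ i)"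
  by (simp add: divergence_def trace_def jacobian_eq[OF assms] matrix_def)

section \<open>Kuhn simplices\<close>

text \<open>\<open>h - f\<close> is affine and nonnegative on \<open>U\<close> with a zero at
  \<open>x\<close>; unless its gradient vanishes, a short step against the gradient makes it
  negative. This turns weak inequalities on a closed simplex into strict ones in its
  interior.\<close>

lemma P1_touching:
  fixes f h :: "real^'n \<Rightarrow> real"
  assumes "P1 f" "P1 h" "open U" "x \<in> U" "\<And>y. y \<in> U \<Longrightarrow> f y \<le> h y" "f x = h x"
  shows "f = h"
proof -
  obtain b w where bw: "\<And>y. h y - f y = b + w \<bullet> y"
    using P1_diff[OF assms(2,1)] unfolding P1_def by blast
  obtain s where s: "s > 0" "x + s *\<^sub>R (- w) \<in> U"
    using open_step[OF assms(3,4)] by blast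
  from assms(5)[OF s(2)] have "0 \<le> b + w \<bullet> (x + s *\<^sub>R (- w))" using bw by (metis diff_ge_0_iff_ge)
  moreover have "b + w \<bullet> x = 0" using bw[of x] assms(6) by simp
  ultimately have "s * (w \<bullet> w) \<le> 0" by (simp add: inner_diff_right)
  then have "w \<bullet> w \<le> 0" using s(1) by (simp add: mult_le_0_iff)
  then have "w = 0" by (metis inner_eq_zero_iff inner_ge_zero order_antisym)
  then have "\<And>y. h y - f y = 0" using bw \<open>b + w \<bullet> x = 0\<close> by simp
  then show ?thesis by (simp add: fun_eq_iff)
qed

lemma convex_P1_le:
  assumes "P1 f" "P1 h" shows "convex {x. f x \<le> h x}"
proof -
  obtain b w where bw: "\<And>y. f y - h y = b + w \<bullet> y"
    using P1_diff[OF assms] unfolding P1_def by blast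
  have "{x. f x \<le> h x} = {x. w \<bullet> x \<le> - b}"
    using bw by (force simp: algebra_simps)
  then show ?thesis by (simp add: convex_halfspace_le)
qed

text \<open>Position in the cell along coordinate \<open>i\<close>, scaled to be 0 at the start and
  1 at the end of the diagonal. This hides the orientation \<open>S\<close>: at a cell vertex the
  positions form the indicator of the coordinates already changed.\<close>

definition cell_pos :: "('n \<Rightarrow> nat \<Rightarrow> real) \<Rightarrow> 'n set \<Rightarrow> ('n \<Rightarrow> nat) \<Rightarrow> 'n \<Rightarrow> real^'n \<Rightarrow> real" where
  "cell_pos g S c i x =
     (x $ i - cell_vertex g S c {} $ i) / (cell_vertex g S c UNIV $ i - cell_vertex g S c {} $ i)"

locale kuhn =
  fixes g :: "'n::finite \<Rightarrow> nat \<Rightarrow> real" and S :: "'n set" and c :: "'n \<Rightarrow> nat" and p :: "nat \<Rightarrow> 'n"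
  assumes cell: "\<And>i. g i (c i) < g i (Suc (c i))" and p: "bij_betw p {1..CARD('n)} UNIV"
begin

abbreviation "vert j \<equiv> cell_vertex g S c (p ` {1..j})"
abbreviation "s \<equiv> cell_pos g S c"

lemma p_surj: obtains j where "1 \<le> j" "j \<le> CARD('n)" "i = p j"
proof -
  have "i \<in> p ` {1..CARD('n)}" using p by (simp add: bij_betw_def)
  then show ?thesis using that by auto
qed

lemma p_mem: "1 \<le> j \<Longrightarrow> j \<le> CARD('n) \<Longrightarrow> k \<le> CARD('n) \<Longrightarrow> p j \<in> p ` {1..k} \<longleftrightarrow> j \<le> k"
  using inj_on_image_mem_iff[of p "{1..CARD('n)}" j "{1..k}"] p by (simp add: bij_betw_def)

lemma P1_coord: "P1 (\<lambda>x::real^'n. x $ i)"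
  by (rule P1I[of _ 0 "axis i 1"]) (simp add: inner_axis')

lemma P1_cell_pos: "P1 (s i)"
proof -
  have "s i = (\<lambda>x. inverse (cell_vertex g S c UNIV $ i - cell_vertex g S c {} $ i) *
      (x $ i - cell_vertex g S c {} $ i))"
    by (simp add: cell_pos_def fun_eq_iff divide_inverse mult.commute)
  then show ?thesis by (simp only:) (intro P1_cmult P1_diff P1_coord P1_const)
qed

lemma cell_pos_vertex: "s i (cell_vertex g S c A) = (if i \<in> A then 1 else 0)"
  using cell[of i] by (auto simp: cell_pos_def cell_vertex_def)

text \<open>Each inequality is affine, so it is enough to check the vertices. At
  \<open>vert m\<close> the first \<open>m\<close> coordinates in the order \<open>p\<close> have
  position 1 and the others 0, whence the decreasing chain of positions typical of a Kuhn
  simplex.\<close>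

lemma hull_subset:
  "convex hull (vert ` {0..CARD('n)}) \<subseteq> {x. g i (c i) \<le> x $ i}"
  "convex hull (vert ` {0..CARD('n)}) \<subseteq> {x. x $ i \<le> g i (Suc (c i))}"
  "1 \<le> j \<Longrightarrow> j \<le> k \<Longrightarrow> k \<le> CARD('n) \<Longrightarrow>
    convex hull (vert ` {0..CARD('n)}) \<subseteq> {x. s (p k) x \<le> s (p j) x}"
proof -
  show "convex hull (vert ` {0..CARD('n)}) \<subseteq> {x. g i (c i) \<le> x $ i}"
    using cell[of i]
    by (intro hull_minimal) (auto simp: cell_vertex_def intro!: convex_P1_le P1_coord)
  show "convex hull (vert ` {0..CARD('n)}) \<subseteq> {x. x $ i \<le> g i (Suc (c i))}"
    using cell[of i]
    by (intro hull_minimal) (auto simp: cell_vertex_def intro!: convex_P1_le P1_coord)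
  assume "1 \<le> j" "j \<le> k" "k \<le> CARD('n)"
  then have "vert m \<in> {x. s (p k) x \<le> s (p j) x}" if "m \<le> CARD('n)" for m
    using that by (simp add: cell_pos_vertex p_mem del: One_nat_def)
  then show "convex hull (vert ` {0..CARD('n)}) \<subseteq> {x. s (p k) x \<le> s (p j) x}"
    by (intro hull_minimal image_subsetI convex_P1_le P1_cell_pos) simp
qed

text \<open>\<open>P1_touching\<close> excludes equality: a coordinate function is not constant, and
  the positions of \<open>p j\<close> and \<open>p k\<close> differ at \<open>vert j\<close>, where
  they are 1 and 0.\<close>

lemma interior_strict:
  assumes "x \<in> kuhn_simplex g S c p"
  shows "g i (c i) < x $ i" "x $ i < g i (Suc (c i))"
    "1 \<le> j \<Longrightarrow> j < k \<Longrightarrow> k \<le> CARD('n) \<Longrightarrow> s (p k) x < s (p j) x"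
proof -
  let ?U = "kuhn_simplex g S c p"
  have U: "open ?U" "?U \<subseteq> convex hull (vert ` {0..CARD('n)})"
    by (simp_all add: kuhn_simplex_def interior_subset)
  have not_const: "(\<lambda>x::real^'n. x $ i) \<noteq> (\<lambda>x. b)" for b
  proof
    assume "(\<lambda>x::real^'n. x $ i) = (\<lambda>x. b)"
    from fun_cong[OF this, of 0] fun_cong[OF this, of "axis i 1"] show False
      by simp
  qed
  have le: "g i (c i) \<le> y $ i" "y $ i \<le> g i (Suc (c i))" if "y \<in> ?U" for y
    using hull_subset(1,2)[of i] U(2) that by blast+
  have "g i (c i) \<noteq> x $ i"
    using P1_touching[OF P1_const P1_coord U(1) assms le(1)] not_const by metis
  then show "g i (c i) < x $ i" using le(1)[OF assms] by simp
  have "x $ i \<noteq> g i (Suc (c i))"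
    using P1_touching[OF P1_coord P1_const U(1) assms le(2)] not_const by metis
  then show "x $ i < g i (Suc (c i))" using le(2)[OF assms] by simp
  assume jk: "1 \<le> j" "j < k" "k \<le> CARD('n)"
  have "s (p k) \<noteq> s (p j)"
  proof
    assume "s (p k) = s (p j)"
    from fun_cong[OF this, of "vert j"] show False
      using jk by (simp add: cell_pos_vertex p_mem del: One_nat_def)
  qed
  moreover have le: "s (p k) y \<le> s (p j) y" if "y \<in> ?U" for y
    using hull_subset(3)[of j k] U(2) that jk by auto
  ultimately have "s (p k) x \<noteq> s (p j) x"
    using P1_touching[OF P1_cell_pos P1_cell_pos U(1) assms le] by blast
  then show "s (p k) x < s (p j) x" using le[OF assms] by simp
qed

text \<open>One step of the walk, from \<open>vert (j - 1)\<close> to \<open>vert j\<close>, changes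
  the coordinate \<open>p j\<close> and no other.\<close>

lemma axis_edge:
  obtains a \<delta> where "\<delta> \<noteq> 0" "a \<in> vert ` {0..CARD('n)}" "a + \<delta> *\<^sub>R axis i 1 \<in> vert ` {0..CARD('n)}"
proof -
  obtain j where j: "1 \<le> j" "j \<le> CARD('n)" "i = p j" by (rule p_surj)
  \<comment> \<open>The walk starts at the upper grid value exactly for coordinates in
    \<open>S\<close>, so there the step goes down.\<close>
  let ?\<delta> = "(if i \<in> S then -1 else 1) * (g i (Suc (c i)) - g i (c i))"
  have "{1..j} = insert j {1..j - 1}" using j(1) by auto
  then have ins: "p ` {1..j} = insert i (p ` {1..j - 1})" using j(3) by auto
  have "i \<notin> p ` {1..j - 1}" using p_mem[of j "j - 1"] j by simp
  then have "vert j = vert (j - 1) + ?\<delta> *\<^sub>R axis i 1"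
    unfolding ins by (auto simp: vec_eq_iff cell_vertex_def axis_def)
  moreover have "?\<delta> \<noteq> 0" using cell[of i] by auto
  ultimately show ?thesis using that[of ?\<delta> "vert (j - 1)"] j by force
qed

end

text \<open>Both enumerations sort by decreasing \<sigma>, and since \<open>p\<close> does so
  strictly there are no ties to break differently. With the positions of a point of an open Kuhn
  simplex as \<sigma>, this rules out every other closed Kuhn simplex of the same cell.\<close>

lemma sorted_enumerations_agree:
  fixes \<sigma> :: "'a \<Rightarrow> real" and N j :: nat
  assumes p: "bij_betw p {1..N} UNIV" and p': "bij_betw p' {1..N} UNIV"
    and strict: "\<And>j k. 1 \<le> j \<Longrightarrow> j < k \<Longrightarrow> k \<le> N \<Longrightarrow> \<sigma> (p k) < \<sigma> (p j)"
    and weak: "\<And>j k. 1 \<le> j \<Longrightarrow> j \<le> k \<Longrightarrow> k \<le> N \<Longrightarrow> \<sigma> (p' k) \<le> \<sigma> (p' j)"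
  shows "j \<le> N \<Longrightarrow> p ` {1..j} = p' ` {1..j}"
proof (induction j)
  case (Suc j)
  have rest: "\<exists>k. j < k \<and> k \<le> N \<and> i = q k" if "bij_betw q {1..N} UNIV" "i \<notin> q ` {1..j}" for q i
  proof -
    have "i \<in> q ` {1..N}" using that(1) by (simp add: bij_betw_def)
    then obtain k where "1 \<le> k" "k \<le> N" "i = q k" by auto
    then show ?thesis using that(2) by (intro exI[of _ k]) (force simp: not_less[symmetric])
  qed
  have fresh: "q (Suc j) \<notin> q ` {1..j}" if "bij_betw q {1..N} UNIV" for q
    using inj_on_image_mem_iff[of q "{1..N}" "Suc j" "{1..j}"] that Suc.prems
    by (simp add: bij_betw_def)
  have IH: "p ` {1..j} = p' ` {1..j}" by (rule Suc.IH) (use Suc.prems in simp)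
  obtain k where k: "j < k" "k \<le> N" "p (Suc j) = p' k"
    using rest[OF p'] fresh[OF p] unfolding IH by blast
  obtain k' where k': "j < k'" "k' \<le> N" "p' (Suc j) = p k'"
    using rest[OF p] fresh[OF p'] unfolding IH by blast
  \<comment> \<open>\<open>p (Suc j)\<close> is among the remaining entries of \<open>p'\<close>, so
    its value is at most that of \<open>p' (Suc j)\<close>, which is \<open>p k'\<close>. Strictness
    of \<open>p\<close> then excludes \<open>k' > Suc j\<close>.\<close>
  have "\<sigma> (p (Suc j)) \<le> \<sigma> (p k')"
    using weak[of "Suc j" k] k k' by simp
  then have "k' = Suc j"
    using strict[of "Suc j" k'] k' by force
  then have "p (Suc j) = p' (Suc j)" using k' by simp
  moreover have "{1..Suc j} = insert (Suc j) {1..j}" by auto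
  ultimately show ?case using IH by (simp del: One_nat_def)
qed simp

section \<open>From single simplices to the mesh\<close>

text \<open>The last clause is the point: an open element misses the closure of every other one. Its
  points lie strictly between consecutive grid planes, which fixes the cell, and the strict order of
  their positions fixes the walk.\<close>

lemma mesh_kuhn:
  fixes lo hi :: "real^'n"
  assumes "cartesian_mesh lo hi M" "T \<in> M"
  obtains g S c p where "kuhn g c p" "T = kuhn_simplex g S c p"
    "\<And>i. lo $ i \<le> g i (c i)" "\<And>i. g i (Suc (c i)) \<le> hi $ i"
    "\<And>T' x. T' \<in> M \<Longrightarrow> x \<in> T \<Longrightarrow> x \<in> closure T' \<Longrightarrow> T' = T"
proof -
  obtain m g S where g: "\<And>i. 0 < m i" "\<And>i. g i 0 = lo $ i" "\<And>i. g i (m i) = hi $ i"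
      "\<And>i. strict_mono_on {0..m i} (g i)"
    and M: "M = {kuhn_simplex g S c p | c p. (\<forall>i. c i < m i) \<and> bij_betw p {1..CARD('n)} UNIV}"
    using assms(1) unfolding cartesian_mesh_def by blast
  obtain c p where c: "\<And>i. c i < m i" and p: "bij_betw p {1..CARD('n)} UNIV"
    and T: "T = kuhn_simplex g S c p"
    using assms(2) unfolding M by blast
  have mono: "g i j \<le> g i k" if "j \<le> k" "k \<le> m i" for i j k
    using strict_mono_onD[OF g(4)[of i], of j k] that by (cases "j = k") auto
  have kuhn: "kuhn g c p" if "\<And>i. c i < m i" "bij_betw p {1..CARD('n)} UNIV" for c p
    using that strict_mono_onD[OF g(4)] by (unfold_locales) (auto simp: Suc_le_eq)
  have "T' = T" if T': "T' \<in> M" and x: "x \<in> T" "x \<in> closure T'" for T' x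
  proof -
    obtain c' p' where c': "\<And>i. c' i < m i" and p': "bij_betw p' {1..CARD('n)} UNIV"
      and T'_eq: "T' = kuhn_simplex g S c' p'"
      using T' unfolding M by blast
    interpret k: kuhn g S c p using kuhn c p .
    interpret k': kuhn g S c' p' using kuhn c' p' .
    have "closure T' \<subseteq> convex hull (k'.vert ` {0..CARD('n)})"
      unfolding T'_eq kuhn_simplex_def
      by (intro closure_minimal interior_subset compact_imp_closed compact_convex_hull
          finite_imp_compact) simp
    then have x': "x \<in> convex hull (k'.vert ` {0..CARD('n)})" using x by blast
    have "c i = c' i" for i
    proof (rule ccontr)
      assume "c i \<noteq> c' i"
      then consider "Suc (c i) \<le> c' i" | "Suc (c' i) \<le> c i" by linarith
      then show False
      proof cases
        case 1
        then have "g i (Suc (c i)) \<le> g i (c' i)" using mono c' less_imp_le by metis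
        then show False
          using k.interior_strict(2)[of x i] k'.hull_subset(1)[of i] x(1) x' by (force simp: T)
      next
        case 2
        then have "g i (Suc (c' i)) \<le> g i (c i)" using mono c less_imp_le by metis
        then show False
          using k.interior_strict(1)[of x i] k'.hull_subset(2)[of i] x(1) x' by (force simp: T)
      qed
    qed
    then have cc': "c' = c" by auto
    have "p ` {1..j} = p' ` {1..j}" if "j \<le> CARD('n)" for j
    proof (rule sorted_enumerations_agree[OF p p' _ _ that])
      fix j k assume "1 \<le> j" "j < k" "k \<le> CARD('n)"
      then show "k.s (p k) x < k.s (p j) x"
        using k.interior_strict(3) x(1) by (simp add: T)
    next
      fix j k assume "1 \<le> j" "j \<le> k" "k \<le> CARD('n)"
      then show "k.s (p' k) x \<le> k.s (p' j) x"
        using k'.hull_subset(3)[of j k] x' unfolding cc' by blast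
    qed
    then have "k'.vert ` {0..CARD('n)} = k.vert ` {0..CARD('n)}"
      unfolding cc' by (intro image_cong refl) (simp del: One_nat_def)
    then show "T' = T"
      unfolding T T'_eq kuhn_simplex_def by simp
  qed
  moreover have "lo $ i \<le> g i (c i)" "g i (Suc (c i)) \<le> hi $ i" for i
    using mono[of 0 "c i" i] mono[of "Suc (c i)" "m i" i] g c[of i] by auto
  ultimately show ?thesis using that kuhn[OF c p] T by blast
qed

text \<open>\<open>Gamma_h\<close>, \<open>Omega_h_plus\<close> and \<open>Omega_h_minus\<close> are
  restricted to \<Omega>; this inclusion removes the restriction inside an element.\<close>

lemma mesh_subset_box:
  assumes "cartesian_mesh lo hi M" "T \<in> M"
  shows "T \<subseteq> box lo hi"
proof -
  obtain g S c p where k: "kuhn g c p" and T: "T = kuhn_simplex g S c p"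
    and b: "\<And>i. lo $ i \<le> g i (c i)" "\<And>i. g i (Suc (c i)) \<le> hi $ i"
    using mesh_kuhn[OF assms] by metis
  interpret kuhn g S c p by (rule k)
  have "lo $ i < x $ i \<and> x $ i < hi $ i" if "x \<in> T" for x i
    using interior_strict(1,2)[of x i] b[of i] that unfolding T by linarith
  then show ?thesis by (auto simp: mem_box_cart)
qed

text \<open>The \<open>THE\<close> in \<open>mesh_interp\<close> quantifies over all elements whose
  closure contains \<open>x\<close>; inside an open element that is this element alone.\<close>

lemma mesh_interp_eq:
  assumes "cartesian_mesh lo hi M" "T \<in> M" "x \<in> T"
  shows "mesh_interp M u x = P1_interp T u x"
proof -
  have "T' = T" if "T' \<in> M" "x \<in> closure T'" for T'
    using mesh_kuhn[OF assms(1,2)] that assms(3) by metis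
  then have eq: "\<forall>T'\<in>M. x \<in> closure T' \<longrightarrow> P1_interp T' u x = P1_interp T u x"
    by blast
  have "x \<in> closure T" using assms(3) closure_subset by blast
  then show ?thesis
    unfolding mesh_interp_def using eq assms(2) by (intro the_equality) blast+
qed

text \<open>Gathers what the analysis on one element takes from the mesh. As \<open>T\<close> is
  nonempty, the hull of the walk has interior, so its closure is recovered from \<open>T\<close> and
  its vertices span the space.\<close>

lemma mesh_vertices:
  fixes T :: "(real^'n) set"
  assumes M: "cartesian_mesh lo hi M" "T \<in> M" and "T \<noteq> {}" and card: "card (vertices T) = CARD('n) + 1"
  shows "open T" and "affine hull (vertices T) = UNIV"
    and "\<exists>q. P1 q \<and> (\<forall>a\<in>vertices T. q a = u a)"
    and "norm n = 1 \<Longrightarrow> \<forall>a\<in>vertices T. b + v \<bullet> a = max 0 (n \<bullet> (a - y)) \<Longrightarrow> 0 \<le> v \<bullet> n \<and> v \<bullet> n \<le> 1"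
proof -
  obtain g S c p where k: "kuhn g c p" and T: "T = kuhn_simplex g S c p"
    using mesh_kuhn[OF M] by metis
  interpret kuhn g S c p by (rule k)
  let ?V = "vert ` {0..CARD('n)}"
  show "open T" by (simp add: T kuhn_simplex_def)
  have "closure T = closure (convex hull ?V)"
    unfolding T kuhn_simplex_def
    using \<open>T \<noteq> {}\<close> by (intro convex_closure_interior) (auto simp: T kuhn_simplex_def)
  then have cl: "closure T = convex hull ?V"
    by (simp add: compact_imp_closed compact_convex_hull finite_imp_compact)
  have "vertices T \<subseteq> ?V"
    unfolding vertices_def cl using extreme_point_of_convex_hull by blast
  \<comment> \<open>The walk has at most \<open>N + 1\<close> points, and by assumption the closed
    simplex has that many extreme points, so every point of the walk is extreme.\<close>
  moreover have "card ?V \<le> card (vertices T)"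
    using card_image_le[of "{0..CARD('n)}" vert] card by simp
  ultimately have V: "vertices T = ?V"
    by (intro card_seteq) auto
  have "T \<subseteq> affine hull ?V"
    using closure_subset[of T] convex_hull_subset_affine_hull[of ?V] cl by blast
  then have "affine hull T \<subseteq> affine hull ?V"
    by (simp add: hull_minimal)
  then show hull: "affine hull (vertices T) = UNIV"
    using affine_hull_open[OF \<open>open T\<close> \<open>T \<noteq> {}\<close>] by (auto simp: V)
  show "\<exists>q. P1 q \<and> (\<forall>a\<in>vertices T. q a = u a)"
  proof -
    \<comment> \<open>\<open>N + 1\<close> points whose affine hull has dimension \<open>N\<close>
      are affinely independent. Their differences to \<open>a0\<close> are then linearly
      independent, so a linear map may be prescribed on them.\<close>
    have "aff_dim (vertices T) = int CARD('n)"
      using hull aff_dim_affine_hull[of "vertices T"] by (simp add: aff_dim_UNIV)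
    then have "\<not> affine_dependent (vertices T)"
      using card by (simp add: affine_independent_iff_card V)
    moreover have "vertices T \<noteq> {}" using card by auto
    then obtain a0 where a0: "a0 \<in> vertices T" by blast
    ultimately have "independent ((\<lambda>x. - a0 + x) ` (vertices T - {a0}))"
      using affine_dependent_iff_dependent2 by blast
    then obtain f :: "real^'n \<Rightarrow> real" where f: "linear f"
      "\<forall>x\<in>(\<lambda>x. - a0 + x) ` (vertices T - {a0}). f x = u (a0 + x) - u a0"
      using linear_independent_extend[of _ "\<lambda>x. u (a0 + x) - u a0"] by metis
    have fdiff: "f (a - a0) = u a - u a0" if "a \<in> vertices T" for a
      using f(2) that linear_0[OF f(1)] by (cases "a = a0") auto
    have "u a0 - f a0 + f a = u a" if "a \<in> vertices T" for a
      using fdiff[OF that] by (simp add: linear_diff[OF f(1)])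
    moreover have "P1 (\<lambda>x. u a0 - f a0 + f x)"
      using P1_add[OF P1_const P1_linear[OF f(1), of 1]] by simp
    ultimately show ?thesis by blast
  qed
  assume n: "norm n = 1" and v: "\<forall>a\<in>vertices T. b + v \<bullet> a = max 0 (n \<bullet> (a - y))"
  \<comment> \<open>Some edge of a Kuhn simplex points in direction \<open>i\<close>. Along it both linear functions change by their
    \<open>i\<close>-th gradient component times the edge length, and taking positive parts is monotone and
    nonexpansive.\<close>
  have "0 \<le> v $ i * n $ i \<and> v $ i * n $ i \<le> n $ i * n $ i" for i
  proof -
    obtain a \<delta> where \<delta>: "\<delta> \<noteq> 0" "a \<in> vertices T" "a + \<delta> *\<^sub>R axis i 1 \<in> vertices T"
      unfolding V by (rule axis_edge)
    define r where "r = n \<bullet> (a - y)"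
    have "b + v \<bullet> a = max 0 r" "b + v \<bullet> a + \<delta> * v $ i = max 0 (r + \<delta> * n $ i)"
      using v[rule_format, OF \<delta>(2)] v[rule_format, OF \<delta>(3)]
      by (simp_all add: r_def inner_add_right inner_diff_right inner_axis algebra_simps)
    then have dv: "\<delta> * v $ i = max 0 (r + \<delta> * n $ i) - max 0 r" by simp
    have "0 \<le> \<delta> * v $ i \<and> \<delta> * v $ i \<le> \<delta> * n $ i \<or> \<delta> * n $ i \<le> \<delta> * v $ i \<and> \<delta> * v $ i \<le> 0"
      unfolding dv by (auto simp: max_def)
    \<comment> \<open>Multiplying by \<open>\<delta> * n $ i\<close> merges the two sign cases and
      leaves the positive factor \<open>\<delta> * \<delta>\<close> to cancel.\<close>
    then have "0 \<le> (\<delta> * v $ i) * (\<delta> * n $ i) \<and> (\<delta> * v $ i) * (\<delta> * n $ i) \<le> (\<delta> * n $ i) * (\<delta> * n $ i)"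
      by (auto intro: mult_nonneg_nonneg mult_nonpos_nonpos mult_right_mono mult_right_mono_neg order_trans)
    then have "0 \<le> (\<delta> * \<delta>) * (v $ i * n $ i)" "(\<delta> * \<delta>) * (v $ i * n $ i) \<le> (\<delta> * \<delta>) * (n $ i * n $ i)"
      by (simp_all only: mult_ac)
    moreover have "0 < \<delta> * \<delta>" using \<delta>(1) by (metis not_real_square_gt_zero)
    ultimately show ?thesis
      using mult_le_cancel_left_pos[of "\<delta> * \<delta>"] by (metis mult_zero_right)
  qed
  then have "0 \<le> (\<Sum>i\<in>UNIV. v $ i * n $ i)" "(\<Sum>i\<in>UNIV. v $ i * n $ i) \<le> (\<Sum>i\<in>UNIV. n $ i * n $ i)"
    by (simp_all add: sum_nonneg sum_mono)
  moreover have "(\<Sum>i\<in>UNIV. n $ i * n $ i) = 1"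
    using n by (simp add: norm_eq_1 inner_vec_def)
  ultimately show "0 \<le> v \<bullet> n \<and> v \<bullet> n \<le> 1"
    by (simp add: inner_vec_def)
qed

text \<open>Both functions vanish at \<open>y\<close>, so they scale along rays from
  \<open>y\<close>, and every ray starts inside the open set \<open>T\<close>. This carries sign
  agreement from \<open>T\<close> to its vertices, where the sign of \<open>d\<close> decides which
  trace is taken.\<close>

lemma P1_same_sign:
  fixes T :: "(real^'n) set"
  assumes L: "P1 L" and T: "open T" "y \<in> T" and "L y = 0"
    and sgn: "\<And>x. x \<in> T \<Longrightarrow> 0 < L x \<longleftrightarrow> 0 < n \<bullet> (x - y)"
  shows "0 < L a \<longleftrightarrow> 0 < n \<bullet> (a - y)"
proof -
  obtain b w where bw: "L = (\<lambda>x. b + w \<bullet> x)" using L unfolding P1_def by blast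
  obtain s where s: "s > 0" "y + s *\<^sub>R (a - y) \<in> T"
    using open_step[OF T] by blast
  have "L (y + s *\<^sub>R (a - y)) = s * L a"
    using \<open>L y = 0\<close> by (simp add: bw inner_add_right inner_diff_right) algebra
  then show ?thesis
    using sgn[OF s(2)] s(1) by (simp add: zero_less_mult_iff)
qed

section \<open>An element cut by a hyperplane\<close>

text \<open>The frame says only that \<open>n\<close> is orthogonal to differences of points of
  \<open>H\<close>. The component of \<open>n\<close> orthogonal to the normal \<open>c\<close> is
  such a difference, so it vanishes and \<open>n\<close> is parallel to \<open>c\<close>. The
  distance is bounded above by orthogonal projection and below by Cauchy-Schwarz.\<close>

lemma infdist_hyperplane:
  fixes n :: "real^'n"
  assumes H: "hyperplane H" "y \<in> H" and n: "norm n = 1" "\<forall>x\<in>H. \<forall>y\<in>H. n \<bullet> (x - y) = 0"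
  shows "H = {x. n \<bullet> (x - y) = 0}" "infdist x H = \<bar>n \<bullet> (x - y)\<bar>"
proof -
  obtain c b where c: "c \<noteq> 0" "H = {x. c \<bullet> x = b}"
    using H(1) unfolding hyperplane_def by blast
  have nn: "n \<bullet> n = 1" using n(1) by (simp add: norm_eq_1)
  define u where "u = n - ((c \<bullet> n) / (c \<bullet> c)) *\<^sub>R c"
  have cu: "c \<bullet> u = 0" using c(1) by (simp add: u_def inner_diff_right)
  then have "y + u \<in> H" using H(2) c(2) by (simp add: inner_add_right)
  then have "n \<bullet> u = 0" using n(2) H(2) by force
  then have "u \<bullet> u = 0" using cu by (simp add: u_def inner_diff_left inner_commute)
  then have "n = ((c \<bullet> n) / (c \<bullet> c)) *\<^sub>R c" by (simp add: u_def)
  then obtain \<alpha> where \<alpha>: "n = \<alpha> *\<^sub>R c" by blast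
  then have "\<alpha> \<noteq> 0" using nn by auto
  then show *: "H = {x. n \<bullet> (x - y) = 0}"
    using H(2) \<alpha> by (auto simp: c(2) inner_diff_right)
  show "infdist x H = \<bar>n \<bullet> (x - y)\<bar>"
  proof (rule antisym)
    let ?p = "x - (n \<bullet> (x - y)) *\<^sub>R n"
    have "?p \<in> H" by (simp add: * inner_diff_right nn)
    then show "infdist x H \<le> \<bar>n \<bullet> (x - y)\<bar>"
      using infdist_le[of ?p H x] n(1) by (simp add: dist_norm)
    have "\<bar>n \<bullet> (x - y)\<bar> \<le> dist x q" if "q \<in> H" for q
    proof -
      have "n \<bullet> (x - y) = n \<bullet> (x - q)"
        using that by (simp add: * inner_diff_right)
      then show ?thesis
        using Cauchy_Schwarz_ineq2[of n "x - q"] n(1) by (simp add: dist_norm)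
    qed
    then show "\<bar>n \<bullet> (x - y)\<bar> \<le> infdist x H"
      using H(2) by (auto simp: infdist_def intro!: cINF_greatest)
  qed
qed

locale cut_element =
  fixes T Tp Tm \<Gamma>hT :: "(real^'n) set" and d w z :: "real^'n \<Rightarrow> real"
    and n xs :: "real^'n" and t :: "nat \<Rightarrow> real^'n" and I :: "nat set" and \<mu>p \<mu>m :: real
    \<comment> \<open>The geometry of the mesh enters through the last assumption only: the interpolant of the positive
      part of \<open>n \<bullet> (x - xs)\<close> has normal slope in \<open>[0, 1]\<close>, whence \<open>1 + (\<mu>m / \<mu>p - 1) * (g \<bullet> n) > 0\<close>.\<close>
  assumes I: "I = {1..CARD('n) - 1}" and open_T: "open T" and xs: "xs \<in> T"
    and Tp: "Tp = {x\<in>T. 0 < n \<bullet> (x - xs)}"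
    and Tm: "Tm = {x\<in>T. n \<bullet> (x - xs) < 0}"
    and \<Gamma>hT: "\<Gamma>hT = {x\<in>T. n \<bullet> (x - xs) = 0}"
    and hull: "affine hull (vertices T) = UNIV"
    and interp: "\<And>u. \<exists>p. P1 p \<and> (\<forall>a\<in>vertices T. p a = u a)"
    and d_pos: "\<And>a. a \<in> vertices T \<Longrightarrow> 0 < d a \<longleftrightarrow> 0 < n \<bullet> (a - xs)"
    and norm_n: "norm n = 1"
    and t_n: "\<And>i. i \<in> I \<Longrightarrow> t i \<bullet> n = 0"
    and t_t: "\<And>i j. i \<in> I \<Longrightarrow> j \<in> I \<Longrightarrow>
                t i \<bullet> t j = (if i = j then 1 else 0)"
    and \<mu>p: "0 < \<mu>p" and \<mu>m: "0 < \<mu>m"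
    and z_Tp: "\<And>x. x \<in> Tp \<Longrightarrow> z x = -1" and z_Tm: "\<And>x. x \<in> Tm \<Longrightarrow> z x = 0"
    and w_Tp: "\<And>x. x \<in> Tp \<Longrightarrow> w x = n \<bullet> (x - xs)" and w_Tm: "\<And>x. x \<in> Tm \<Longrightarrow> w x = 0"
    and slope: "\<And>b g. (\<forall>a\<in>vertices T. b + g \<bullet> a = max 0 (n \<bullet> (a - xs))) \<Longrightarrow>
                  0 \<le> g \<bullet> n \<and> g \<bullet> n \<le> 1"
begin

abbreviation "W \<equiv> broken_interp d Tp Tm T w"
abbreviation "Z \<equiv> broken_interp d Tp Tm T z"
abbreviation "V \<equiv> ife_space \<mu>p \<mu>m Tp Tm \<Gamma>hT xs n"

lemma nn: "n \<bullet> n = 1"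
  using norm_n by (simp add: norm_eq_1)

lemma n_t: "i \<in> I \<Longrightarrow> n \<bullet> t i = 0"
  using t_n by (simp add: inner_commute)

text \<open>From the interior point \<open>xs\<close> on the cut, short steps along \<open>n\<close>
  and \<open>-n\<close> reach both parts, so they are nonempty and open.\<close>

lemma affine_hull_parts: "affine hull Tp = UNIV" "affine hull Tm = UNIV"
proof -
  obtain s s' where "s > 0" "xs + s *\<^sub>R n \<in> T" "s' > 0" "xs + s' *\<^sub>R (- n) \<in> T"
    using open_step[OF open_T xs] by metis
  then have "xs + s *\<^sub>R n \<in> Tp" "xs + s' *\<^sub>R (- n) \<in> Tm"
    by (auto simp: Tp Tm nn)
  moreover have "Tp = T \<inter> {x. 0 < n \<bullet> (x - xs)}" "Tm = T \<inter> {x. n \<bullet> (x - xs) < 0}"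
    by (auto simp: Tp Tm)
  then have "open Tp" "open Tm"
    using open_T by (auto intro!: open_Int open_Collect_less continuous_intros)
  ultimately show "affine hull Tp = UNIV" "affine hull Tm = UNIV"
    by (auto intro!: affine_hull_open)
qed

lemma P1_ext_parts:
  "P1 p \<Longrightarrow> (\<And>x. x \<in> Tp \<Longrightarrow> f x = p x) \<Longrightarrow> P1_ext Tp f = p"
  "P1 p \<Longrightarrow> (\<And>x. x \<in> Tm \<Longrightarrow> f x = p x) \<Longrightarrow> P1_ext Tm f = p"
  using P1_ext_eq affine_hull_parts by blast+

lemma P1_ext_vec_parts:
  "\<forall>i. P1 (\<lambda>x. f x $ i) \<Longrightarrow> (\<And>x. x \<in> Tp \<Longrightarrow> v x = f x) \<Longrightarrow> P1_ext_vec Tp v = f"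
  "\<forall>i. P1 (\<lambda>x. f x $ i) \<Longrightarrow> (\<And>x. x \<in> Tm \<Longrightarrow> v x = f x) \<Longrightarrow> P1_ext_vec Tm v = f"
  using P1_ext_vec_eq affine_hull_parts by blast+

text \<open>By \<open>d_pos\<close> the sign of \<open>d\<close> at a vertex tells its side of the
  cut; a vertex on the cut falls into the minus case, as the convention demands.\<close>

lemma vertex_value_broken:
  assumes "P1 p" "P1 p'" "\<And>x. x \<in> Tp \<Longrightarrow> f x = p x" "\<And>x. x \<in> Tm \<Longrightarrow> f x = p' x" "a \<in> vertices T"
  shows "vertex_value d Tp Tm f a = (if 0 < n \<bullet> (a - xs) then p a else p' a)"
  using assms d_pos by (simp add: vertex_value_def P1_ext_parts)

lemma vertex_value_P1: "P1 p \<Longrightarrow> a \<in> vertices T \<Longrightarrow> vertex_value d Tp Tm p a = p a"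
  using vertex_value_broken[of p p p a] by simp

section \<open>Interpolants of \<open>w\<close> and \<open>z\<close>\<close>

lemma P1_interp:
  "P1 (P1_interp T u)" "a \<in> vertices T \<Longrightarrow> P1_interp T u a = u a"
  using interp[of u] P1_interp_eq[OF hull] by metis+

lemma P1_W: "P1 W" and W_vertex: "a \<in> vertices T \<Longrightarrow> W a = max 0 (n \<bullet> (a - xs))"
  using P1_interp vertex_value_broken[of "\<lambda>x. n \<bullet> (x - xs)" "\<lambda>x. 0" w a] w_Tp w_Tm
  by (auto simp: broken_interp_def)

lemma P1_Z: "P1 Z" and Z_vertex: "a \<in> vertices T \<Longrightarrow> Z a = (if 0 < n \<bullet> (a - xs) then -1 else 0)"
  using P1_interp vertex_value_broken[of "\<lambda>x. -1" "\<lambda>x. 0" z a] z_Tp z_Tm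
  by (auto simp: broken_interp_def)

text \<open>\<open>W\<close> is affine, so its gradient is constant and evaluation at
  \<open>xs\<close> is an arbitrary choice.\<close>

definition "g = grad W xs"

lemma W_affine: obtains b where "W = (\<lambda>x. b + g \<bullet> x)"
proof -
  obtain b v where "W = (\<lambda>x. b + v \<bullet> x)" using P1_W unfolding P1_def by blast
  then show ?thesis using that by (simp add: g_def)
qed

lemma grad_W: "grad W x = g"
  using W_affine grad_affine by metis

text \<open>The denominator is the convex combination of 1 and \<open>\<mu>m / \<mu>p\<close> with
  weight \<open>g \<bullet> n\<close> on the second.\<close>

lemma denominator_pos: "0 < 1 + (\<mu>m / \<mu>p - 1) * (g \<bullet> n)"
proof -
  obtain b where b: "W = (\<lambda>x. b + g \<bullet> x)" by (rule W_affine)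
  have g: "0 \<le> g \<bullet> n" "g \<bullet> n \<le> 1"
    using slope[of b g] W_vertex by (auto simp: b)
  have "1 + (\<mu>m / \<mu>p - 1) * (g \<bullet> n) = (1 - g \<bullet> n) + (\<mu>m / \<mu>p) * (g \<bullet> n)"
    by (simp add: algebra_simps)
  moreover have "\<dots> > 0"
    using g \<mu>p \<mu>m by (cases "g \<bullet> n = 0") (auto intro!: add_nonneg_pos)
  ultimately show ?thesis by simp
qed

section \<open>The orthonormal frame and jumps across the cut\<close>

lemma orthonormal_expansion: "x = (\<Sum>i\<in>I. (t i \<bullet> x) *\<^sub>R t i) + (n \<bullet> x) *\<^sub>R n"
proof -
  let ?B = "insert n (t ` I)"
  have inj: "inj_on t I"
  proof (rule inj_onI)
    fix i j assume "i \<in> I" "j \<in> I" "t i = t j"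
    then have "t i \<bullet> t j = 1" using t_t[of i i] by simp
    then show "i = j" using t_t[of i j] \<open>i \<in> I\<close> \<open>j \<in> I\<close> by (auto split: if_splits)
  qed
  have n_notin: "n \<notin> t ` I" using t_n nn by (auto simp: image_iff)
  have norm: "\<And>x. x \<in> ?B \<Longrightarrow> norm x = 1"
    using norm_n t_t by (auto simp: norm_eq_1)
  have orth: "pairwise orthogonal ?B"
    using t_n n_t t_t by (auto simp: pairwise_def orthogonal_def)
  have "0 \<notin> ?B" using norm by (metis norm_zero zero_neq_one)
  then have "independent ?B" using orth pairwise_orthogonal_independent by blast
  moreover have "card ?B = DIM(real^'n)"
    using n_notin inj by (simp add: card_image I)
  ultimately have "span ?B = UNIV"
    using card_ge_dim_independent[of ?B UNIV] by (auto simp: dim_UNIV)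
  then have "x = (\<Sum>b\<in>?B. (b \<bullet> x) *\<^sub>R b)"
    using orthonormal_basis_expand[OF orth norm, of x] by (simp add: inner_commute I)
  also have "\<dots> = (\<Sum>i\<in>I. (t i \<bullet> x) *\<^sub>R t i) + (n \<bullet> x) *\<^sub>R n"
    using n_notin inj by (simp add: sum.reindex I)
  finally show ?thesis .
qed

lemma frame_eqI:
  assumes "n \<bullet> x = n \<bullet> y" "\<And>i. i \<in> I \<Longrightarrow> t i \<bullet> x = t i \<bullet> y"
  shows "x = y"
  using orthonormal_expansion[of x] orthonormal_expansion[of y] assms by (simp cong: sum.cong)

text \<open>Continuity along the cut makes the jump of the derivative vanish on tangential vectors,
  because a short tangential step from \<open>xs\<close> stays in \<open>T\<close>. What remains is
  a rank-one map.\<close>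

lemma jump_normal:
  assumes "linear L" "linear L'" "\<And>x. x \<in> \<Gamma>hT \<Longrightarrow> b' + L' x = b + L x"
  obtains c where "\<And>u. L' u = L u + (n \<bullet> u) *\<^sub>R c"
    "\<And>x. b' + L' x = b + L x + (n \<bullet> (x - xs)) *\<^sub>R c"
proof -
  define D where "D = (\<lambda>u. L' u - L u)"
  have D: "linear D" using assms linear_compose_sub by (simp add: D_def)
  have tang: "D u = 0" if "n \<bullet> u = 0" for u
  proof -
    obtain s where s: "s > 0" "xs + s *\<^sub>R u \<in> T"
      using open_step[OF open_T xs] by blast
    then have "xs + s *\<^sub>R u \<in> \<Gamma>hT" "xs \<in> \<Gamma>hT"
      using xs that by (auto simp: \<Gamma>hT)
    note eq = assms(3)[OF this(1)] assms(3)[OF this(2)]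
    have "b' + L' xs + s *\<^sub>R L' u = b + L xs + s *\<^sub>R L u"
      using eq(1) by (simp add: linear_add[OF assms(1)] linear_add[OF assms(2)]
          linear_scale[OF assms(1)] linear_scale[OF assms(2)] add.assoc)
    then have "s *\<^sub>R D u = 0"
      unfolding eq(2) by (simp add: D_def algebra_simps)
    then show ?thesis using s(1) by simp
  qed
  have "D u = (n \<bullet> u) *\<^sub>R D n" for u
    using tang[of "u - (n \<bullet> u) *\<^sub>R n"]
    by (simp add: inner_diff_right nn linear_diff[OF D] linear_scale[OF D])
  then have L': "L' u = L u + (n \<bullet> u) *\<^sub>R D n" for u
    by (metis D_def add_diff_cancel_left' diff_add_cancel add.commute)
  have "xs \<in> \<Gamma>hT" using xs by (simp add: \<Gamma>hT)
  from assms(3)[OF this] have "b' = b - (n \<bullet> xs) *\<^sub>R D n"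
    by (simp add: L' algebra_simps)
  then have "b' + L' x = b + L x + (n \<bullet> (x - xs)) *\<^sub>R D n" for x
    by (simp add: L' inner_diff_right algebra_simps)
  with L' show ?thesis using that by blast
qed

lemma broken_P1_vec:
  fixes v :: "real^'n \<Rightarrow> real^'n"
  assumes "\<forall>i. \<exists>p. P1 p \<and> (\<forall>x\<in>A. v x $ i = p x)"
  obtains b L where "linear L" "\<And>x. x \<in> A \<Longrightarrow> v x = b + L x"
proof -
  obtain p where p: "\<And>i. P1 (p i)" "\<And>i x. x \<in> A \<Longrightarrow> v x $ i = p i x"
    using assms by metis
  have "\<forall>i. P1 (\<lambda>x. (\<chi> i. p i x) $ i)" using p(1) by simp
  then obtain b L where "linear L" "(\<lambda>x. \<chi> i. p i x) = (\<lambda>x. b + L x)"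
    unfolding P1_vec_iff by blast
  moreover have "v x = (\<chi> i. p i x)" if "x \<in> A" for x
    using p(2)[OF that] by (simp add: vec_eq_iff)
  ultimately show ?thesis using that by metis
qed

lemma P1_vec_affine: "linear L \<Longrightarrow> \<forall>i. P1 (\<lambda>x. (b + L x) $ i)"
  for L :: "real^'n \<Rightarrow> real^'n"
  using P1_vec_iff[of "\<lambda>x. b + L x"] by blast

text \<open>As \<open>c\<close> is tangential it drops out of the normal component, which fixes the
  pressure jump. As \<open>t i\<close> is orthogonal to \<open>n\<close>, the pressure drops out of
  the tangential components, which fix \<open>c\<close>.\<close>

lemma stress_jump:
  assumes L: "linear L" "linear L'" and L': "\<And>u. L' u = L u + (n \<bullet> u) *\<^sub>R c" and c: "n \<bullet> c = 0"
  shows "stress \<mu>p (\<lambda>x. b' + L' x) Q' x *v n - stress \<mu>m (\<lambda>x. b + L x) Q x *v n = 0 \<longleftrightarrow>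
    Q' x - Q x = 2 * (\<mu>p - \<mu>m) * (n \<bullet> L n) \<and>
    (\<forall>i\<in>I. \<mu>p * (t i \<bullet> c) = (\<mu>m - \<mu>p) * (t i \<bullet> L n + n \<bullet> L (t i)))" (is "?s = 0 \<longleftrightarrow> _")
proof -
  note stress = inner_stress[OF has_derivative_affine[OF L(1)]] inner_stress[OF has_derivative_affine[OF L(2)]]
  have "n \<bullet> ?s = 2 * (\<mu>p - \<mu>m) * (n \<bullet> L n) - (Q' x - Q x)"
    unfolding inner_diff_right stress by (simp add: L' nn c inner_add_right algebra_simps)
  moreover have "t i \<bullet> ?s = \<mu>p * (t i \<bullet> c) - (\<mu>m - \<mu>p) * (t i \<bullet> L n + n \<bullet> L (t i))" if "i \<in> I" for i
    using that unfolding inner_diff_right stress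
    by (simp add: L' nn n_t t_n inner_add_right algebra_simps)
  moreover have "?s = 0 \<longleftrightarrow> n \<bullet> ?s = 0 \<and> (\<forall>i\<in>I. t i \<bullet> ?s = 0)"
    using frame_eqI[of ?s 0] by auto
  ultimately show ?thesis by auto
qed

text \<open>This is the trace of the rank-one map \<open>u\<close> to
  \<open>(n \<bullet> u) c\<close>. Continuity of the divergence therefore says that
  \<open>c\<close> is tangential.\<close>

lemma divergence_jump:
  assumes L: "linear L" "linear L'" and L': "\<And>u. L' u = L u + (n \<bullet> u) *\<^sub>R c"
  shows "divergence (\<lambda>x. b' + L' x) x - divergence (\<lambda>x. b + L x) x = n \<bullet> c"
  unfolding divergence_eq[OF has_derivative_affine[OF L(1)]]
    divergence_eq[OF has_derivative_affine[OF L(2)]]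
  by (simp add: L' sum.distrib inner_axis) (simp add: inner_vec_def)

text \<open>Normal form of the space: the minus piece \<open>(b, L, Q)\<close> is free, and the
  interface conditions determine the plus piece from it. Membership is used only in this form
  afterwards.\<close>

lemma ife_space_iff:
  "(v, q) \<in> V \<longleftrightarrow> (\<exists>b L c Q. linear L \<and> P1 Q \<and> n \<bullet> c = 0 \<and>
     (\<forall>i\<in>I. \<mu>p * (t i \<bullet> c) = (\<mu>m - \<mu>p) * (t i \<bullet> L n + n \<bullet> L (t i))) \<and>
     (\<forall>x\<in>Tm. v x = b + L x \<and> q x = Q x) \<and>
     (\<forall>x\<in>Tp. v x = b + L x + (n \<bullet> (x - xs)) *\<^sub>R c \<and> q x = Q x + 2 * (\<mu>p - \<mu>m) * (n \<bullet> L n)))"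
proof
  assume "(v, q) \<in> V"
  then have broken: "\<forall>i. \<exists>p. P1 p \<and> (\<forall>x\<in>Tp. v x $ i = p x)" "\<forall>i. \<exists>p. P1 p \<and> (\<forall>x\<in>Tm. v x $ i = p x)"
      "\<exists>p. P1 p \<and> (\<forall>x\<in>Tp. q x = p x)" "\<exists>p. P1 p \<and> (\<forall>x\<in>Tm. q x = p x)"
    and stress: "stress \<mu>p (P1_ext_vec Tp v) (P1_ext Tp q) xs *v n
         - stress \<mu>m (P1_ext_vec Tm v) (P1_ext Tm q) xs *v n = 0"
    and cont: "\<forall>x\<in>\<Gamma>hT. P1_ext_vec Tp v x - P1_ext_vec Tm v x = 0"
    and div: "\<forall>x\<in>\<Gamma>hT. divergence (P1_ext_vec Tp v) x - divergence (P1_ext_vec Tm v) x = 0"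
    and grad: "\<forall>x\<in>\<Gamma>hT. grad (P1_ext Tp q) x - grad (P1_ext Tm q) x = 0"
    by (auto simp: ife_space_def broken_P1_def)
  obtain b L where L: "linear L" "\<And>x. x \<in> Tm \<Longrightarrow> v x = b + L x"
    using broken_P1_vec[OF broken(2)] by blast
  obtain b' L' where L': "linear L'" "\<And>x. x \<in> Tp \<Longrightarrow> v x = b' + L' x"
    using broken_P1_vec[OF broken(1)] by blast
  obtain Q Q' where Q: "P1 Q" "\<And>x. x \<in> Tm \<Longrightarrow> q x = Q x" and Q': "P1 Q'" "\<And>x. x \<in> Tp \<Longrightarrow> q x = Q' x"
    using broken(3,4) by blast
  have exts: "P1_ext_vec Tp v = (\<lambda>x. b' + L' x)" "P1_ext_vec Tm v = (\<lambda>x. b + L x)"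
    "P1_ext Tp q = Q'" "P1_ext Tm q = Q"
    using P1_ext_vec_parts P1_ext_parts P1_vec_affine L L' Q Q' by simp_all
  have xs_\<Gamma>: "xs \<in> \<Gamma>hT" using xs by (simp add: \<Gamma>hT)
  obtain c where c: "\<And>u. L' u = L u + (n \<bullet> u) *\<^sub>R c"
      "\<And>x. b' + L' x = b + L x + (n \<bullet> (x - xs)) *\<^sub>R c"
    using jump_normal[OF L(1) L'(1), of b' b] cont by (auto simp: exts)
  have nc: "n \<bullet> c = 0"
    using div[unfolded exts divergence_jump[OF L(1) L'(1) c(1)]] xs_\<Gamma> by blast
  note jump = stress[unfolded exts stress_jump[OF L(1) L'(1) c(1) nc]]
  obtain k v' where Q_eq: "Q = (\<lambda>x. k + v' \<bullet> x)" using Q(1) unfolding P1_def by blast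
  obtain k' v'' where Q'_eq: "Q' = (\<lambda>x. k' + v'' \<bullet> x)" using Q'(1) unfolding P1_def by blast
  \<comment> \<open>Equal pressure gradients make \<open>Q' - Q\<close> constant, so the stress
    condition at the single point \<open>xs\<close> gives its value everywhere.\<close>
  have "v' = v''" using grad xs_\<Gamma> unfolding exts Q_eq Q'_eq by auto
  then have "Q' x = Q x + 2 * (\<mu>p - \<mu>m) * (n \<bullet> L n)" for x
    using jump by (simp add: Q_eq Q'_eq)
  then show "\<exists>b L c Q. linear L \<and> P1 Q \<and> n \<bullet> c = 0 \<and>
     (\<forall>i\<in>I. \<mu>p * (t i \<bullet> c) = (\<mu>m - \<mu>p) * (t i \<bullet> L n + n \<bullet> L (t i))) \<and>
     (\<forall>x\<in>Tm. v x = b + L x \<and> q x = Q x) \<and>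
     (\<forall>x\<in>Tp. v x = b + L x + (n \<bullet> (x - xs)) *\<^sub>R c \<and> q x = Q x + 2 * (\<mu>p - \<mu>m) * (n \<bullet> L n))"
    using L L' Q Q' nc jump c(2) by (intro exI[of _ b] exI[of _ L] exI[of _ c] exI[of _ Q]) auto
next
  assume "\<exists>b L c Q. linear L \<and> P1 Q \<and> n \<bullet> c = 0 \<and>
     (\<forall>i\<in>I. \<mu>p * (t i \<bullet> c) = (\<mu>m - \<mu>p) * (t i \<bullet> L n + n \<bullet> L (t i))) \<and>
     (\<forall>x\<in>Tm. v x = b + L x \<and> q x = Q x) \<and>
     (\<forall>x\<in>Tp. v x = b + L x + (n \<bullet> (x - xs)) *\<^sub>R c \<and> q x = Q x + 2 * (\<mu>p - \<mu>m) * (n \<bullet> L n))"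
  then obtain b L c Q where L: "linear L" and Q: "P1 Q" and c: "n \<bullet> c = 0"
     "\<forall>i\<in>I. \<mu>p * (t i \<bullet> c) = (\<mu>m - \<mu>p) * (t i \<bullet> L n + n \<bullet> L (t i))"
    and minus: "\<And>x. x \<in> Tm \<Longrightarrow> v x = b + L x" "\<And>x. x \<in> Tm \<Longrightarrow> q x = Q x"
    and plus: "\<And>x. x \<in> Tp \<Longrightarrow> v x = b + L x + (n \<bullet> (x - xs)) *\<^sub>R c"
      "\<And>x. x \<in> Tp \<Longrightarrow> q x = Q x + 2 * (\<mu>p - \<mu>m) * (n \<bullet> L n)"
    by blast
  define L' where "L' = (\<lambda>u. L u + (n \<bullet> u) *\<^sub>R c)"
  define b' where "b' = b - (n \<bullet> xs) *\<^sub>R c"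
  define Q' where "Q' = (\<lambda>x. Q x + 2 * (\<mu>p - \<mu>m) * (n \<bullet> L n))"
  have L': "linear L'" "\<And>u. L' u = L u + (n \<bullet> u) *\<^sub>R c"
    unfolding L'_def
    by (auto intro!: linearI simp: linear_add[OF L] linear_scale[OF L] inner_add_right algebra_simps)
  have Q': "P1 Q'" unfolding Q'_def by (intro P1_add Q P1_const)
  have plus': "v x = b' + L' x" "q x = Q' x" if "x \<in> Tp" for x
    using plus[OF that] by (simp_all add: b'_def L'_def Q'_def inner_diff_right algebra_simps)
  have exts: "P1_ext_vec Tp v = (\<lambda>x. b' + L' x)" "P1_ext_vec Tm v = (\<lambda>x. b + L x)"
    "P1_ext Tp q = Q'" "P1_ext Tm q = Q"
    using P1_ext_vec_parts P1_ext_parts P1_vec_affine L L'(1) Q Q' minus plus' by simp_all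
  have "\<exists>p. P1 p \<and> (\<forall>x\<in>Tp. v x $ i = p x)" for i
    using P1_vec_affine[OF L'(1), of b'] plus'(1) by (intro exI[of _ "\<lambda>x. (b' + L' x) $ i"]) simp
  moreover have "\<exists>p. P1 p \<and> (\<forall>x\<in>Tm. v x $ i = p x)" for i
    using P1_vec_affine[OF L, of b] minus(1) by (intro exI[of _ "\<lambda>x. (b + L x) $ i"]) simp
  moreover have "\<exists>p. P1 p \<and> (\<forall>x\<in>Tp. q x = p x)" "\<exists>p. P1 p \<and> (\<forall>x\<in>Tm. q x = p x)"
    using Q Q' plus' minus by blast+
  moreover have "b' + L' x - (b + L x) = 0" if "x \<in> \<Gamma>hT" for x
    using that by (simp add: b'_def L'_def \<Gamma>hT inner_diff_right)
  moreover have "divergence (\<lambda>x. b' + L' x) x - divergence (\<lambda>x. b + L x) x = 0" for x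
    using divergence_jump[OF L L'] c(1) by simp
  moreover have "stress \<mu>p (\<lambda>x. b' + L' x) Q' xs *v n - stress \<mu>m (\<lambda>x. b + L x) Q xs *v n = 0"
    using stress_jump[OF L L' c(1)] c(2) by (simp add: Q'_def)
  moreover obtain k u where "Q = (\<lambda>x. k + u \<bullet> x)" using Q unfolding P1_def by blast
  then have "grad Q' x - grad Q x = 0" for x
    using grad_affine[of "k + 2 * (\<mu>p - \<mu>m) * (n \<bullet> L n)" u] by (simp add: Q'_def algebra_simps)
  ultimately show "(v, q) \<in> V"
    by (simp add: ife_space_def broken_P1_def exts)
qed

section \<open>The lift of an affine pair into the broken space\<close>

text \<open>The velocity formula as an operator on arbitrary affine fields. The two cases of the
  theorem arise from it and \<open>lift_q\<close> when one member of the pair is zero.\<close>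

definition lift_v :: "(real^'n \<Rightarrow> real^'n) \<Rightarrow> real^'n \<Rightarrow> real^'n" where
  "lift_v \<phi> x = \<phi> x + (\<Sum>i\<in>I.
     ((t i \<bullet> (stress (\<mu>m / \<mu>p - 1) \<phi> (\<lambda>_. 0) x *v n))
       / (1 + (\<mu>m / \<mu>p - 1) * (grad W x \<bullet> n)) * (w x - W x)) *\<^sub>R t i)"

definition lift_q :: "(real^'n \<Rightarrow> real^'n) \<Rightarrow> (real^'n \<Rightarrow> real) \<Rightarrow> real^'n \<Rightarrow> real" where
  "lift_q \<phi> \<psi> x = \<psi> x + (n \<bullet> (stress (\<mu>m - \<mu>p) \<phi> (\<lambda>_. 0) x *v n)) * (z x - Z x)"

text \<open>Clearing the denominator gives an implicit equation for \<open>C\<close>. The minus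
  piece of the lift has slope \<open>L u - (g \<bullet> u) C\<close>, so the term with
  \<open>g \<bullet> n\<close> turns the equation into the jump condition of
  \<open>ife_space_iff\<close> for that piece.\<close>

lemma lift_affine:
  assumes L: "linear L"
  obtains C where "n \<bullet> C = 0"
    "\<And>i. i \<in> I \<Longrightarrow> \<mu>p * (t i \<bullet> C) = (\<mu>m - \<mu>p) * (t i \<bullet> L n + n \<bullet> L (t i) - (g \<bullet> n) * (t i \<bullet> C))"
    "\<And>x. lift_v (\<lambda>x. b + L x) x = b + L x + (w x - W x) *\<^sub>R C"
    "\<And>x \<psi>. lift_q (\<lambda>x. b + L x) \<psi> x = \<psi> x + 2 * (\<mu>m - \<mu>p) * (n \<bullet> L n) * (z x - Z x)"
proof -
  note stress = inner_stress[OF has_derivative_affine[OF L]]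
  define \<kappa> where "\<kappa> = \<mu>m / \<mu>p - 1"
  define \<gamma> where "\<gamma> i = \<kappa> * (t i \<bullet> L n + n \<bullet> L (t i)) / (1 + \<kappa> * (g \<bullet> n))" for i
  define C where "C = (\<Sum>i\<in>I. \<gamma> i *\<^sub>R t i)"
  have "n \<bullet> C = 0"
    by (simp add: C_def inner_sum_right n_t)
  moreover have tC: "t i \<bullet> C = \<gamma> i" if "i \<in> I" for i
  proof -
    have "finite I" by (simp add: I)
    have "t i \<bullet> C = (\<Sum>j\<in>I. if i = j then \<gamma> j else 0)"
      unfolding C_def inner_sum_right by (rule sum.cong) (auto simp: t_t that)
    then show ?thesis using that \<open>finite I\<close> by simp
  qed
  have "\<mu>p * (t i \<bullet> C) = (\<mu>m - \<mu>p) * (t i \<bullet> L n + n \<bullet> L (t i) - (g \<bullet> n) * (t i \<bullet> C))" if "i \<in> I" for i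
  proof -
    have "(1 + \<kappa> * (g \<bullet> n)) * (t i \<bullet> C) = \<kappa> * (t i \<bullet> L n + n \<bullet> L (t i))"
      using denominator_pos by (simp add: tC[OF that] \<gamma>_def \<kappa>_def)
    then have "\<mu>p * (t i \<bullet> C) + (\<mu>p * \<kappa>) * (g \<bullet> n) * (t i \<bullet> C) = (\<mu>p * \<kappa>) * (t i \<bullet> L n + n \<bullet> L (t i))"
      by algebra
    moreover have "\<mu>p * \<kappa> = \<mu>m - \<mu>p" using \<mu>p by (simp add: \<kappa>_def field_simps)
    ultimately have "\<mu>p * (t i \<bullet> C) + (\<mu>m - \<mu>p) * (g \<bullet> n) * (t i \<bullet> C) = (\<mu>m - \<mu>p) * (t i \<bullet> L n + n \<bullet> L (t i))"
      by simp
    then show ?thesis by (simp add: algebra_simps)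
  qed
  moreover have "lift_v (\<lambda>x. b + L x) x = b + L x + (w x - W x) *\<^sub>R C" for x
    by (simp add: lift_v_def stress grad_W C_def scaleR_sum_right \<gamma>_def \<kappa>_def mult.commute)
  moreover have "lift_q (\<lambda>x. b + L x) \<psi> x = \<psi> x + 2 * (\<mu>m - \<mu>p) * (n \<bullet> L n) * (z x - Z x)" for x \<psi>
    by (simp add: lift_q_def stress)
  ultimately show ?thesis using that by blast
qed

lemma P1_eq_on_vertices: "P1 p \<Longrightarrow> P1 q \<Longrightarrow> (\<And>a. a \<in> vertices T \<Longrightarrow> p a = q a) \<Longrightarrow> p = q"
  using P1_eq_on_hull[of p q "vertices T"] hull by blast

text \<open>Uniqueness half: vertex values identify \<phi> as the minus piece plus \<open>W\<close>
  times the jump \<open>c\<close>, so everything hinges on showing that \<open>c\<close> is the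
  vector \<open>C\<close> of the lift.\<close>

lemma lift_unique:
  assumes V: "(v, q) \<in> V" and P1: "\<forall>i. P1 (\<lambda>x. \<phi> x $ i)" "P1 \<psi>"
    and vertex: "\<And>a i. a \<in> vertices T \<Longrightarrow> vertex_value d Tp Tm (\<lambda>x. v x $ i) a = \<phi> a $ i"
      "\<And>a. a \<in> vertices T \<Longrightarrow> vertex_value d Tp Tm q a = \<psi> a"
    and x: "x \<in> Tp \<union> Tm"
  shows "v x = lift_v \<phi> x" "q x = lift_q \<phi> \<psi> x"
proof -
  obtain b L c Q where L: "linear L" and Q: "P1 Q" and nc: "n \<bullet> c = 0"
    and c: "\<And>i. i \<in> I \<Longrightarrow> \<mu>p * (t i \<bullet> c) = (\<mu>m - \<mu>p) * (t i \<bullet> L n + n \<bullet> L (t i))"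
    and minus: "\<And>x. x \<in> Tm \<Longrightarrow> v x = b + L x" "\<And>x. x \<in> Tm \<Longrightarrow> q x = Q x"
    and plus: "\<And>x. x \<in> Tp \<Longrightarrow> v x = b + L x + (n \<bullet> (x - xs)) *\<^sub>R c"
      "\<And>x. x \<in> Tp \<Longrightarrow> q x = Q x + 2 * (\<mu>p - \<mu>m) * (n \<bullet> L n)"
    using V unfolding ife_space_iff by blast
  obtain b0 L0 where L0: "linear L0" and \<phi>: "\<phi> = (\<lambda>x. b0 + L0 x)"
    using P1(1) unfolding P1_vec_iff by blast
  obtain \<beta> where W: "W = (\<lambda>x. \<beta> + g \<bullet> x)" by (rule W_affine)
  let ?q0 = "2 * (\<mu>p - \<mu>m) * (n \<bullet> L n)"
  have P1_L: "P1 (\<lambda>x. (b + L x) $ i)" for i using P1_vec_affine[OF L] by blast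
  have P1_jump: "P1 (\<lambda>x. (b + L x) $ i + c $ i * (n \<bullet> (x - xs)))"
    "P1 (\<lambda>x. (b + L x) $ i + c $ i * W x)" for i
    by (intro P1_add P1_cmult P1_L P1_inner_diff P1_W)+
  have "(\<lambda>x. \<phi> x $ i) = (\<lambda>x. (b + L x) $ i + c $ i * W x)" for i
  proof (rule P1_eq_on_vertices)
    fix a assume a: "a \<in> vertices T"
    then have "\<phi> a $ i = (if 0 < n \<bullet> (a - xs) then (b + L a) $ i + c $ i * (n \<bullet> (a - xs)) else (b + L a) $ i)"
      using vertex_value_broken[OF P1_jump(1)[of i] P1_L[of i], of "\<lambda>x. v x $ i" a] plus(1) minus(1) vertex(1)
      by (simp add: mult.commute)
    then show "\<phi> a $ i = (b + L a) $ i + c $ i * W a"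
      by (simp add: W_vertex[OF a] max_def)
  qed (use P1 P1_jump in auto)
  then have \<phi>_eq: "\<phi> x = b + L x + W x *\<^sub>R c" for x
    by (simp add: vec_eq_iff fun_eq_iff mult.commute)
  from \<phi>_eq[of 0] have "b0 = b + \<beta> *\<^sub>R c"
    by (simp add: \<phi> W linear_0[OF L] linear_0[OF L0])
  then have L0_eq: "L0 u = L u + (g \<bullet> u) *\<^sub>R c" for u
    using \<phi>_eq[of u] by (simp add: \<phi> W scaleR_add_left)
  have "\<psi> = (\<lambda>x. Q x + (- ?q0) * Z x)"
  proof (rule P1_eq_on_vertices)
    fix a assume a: "a \<in> vertices T"
    have "P1 (\<lambda>x. Q x + ?q0)" by (intro P1_add Q P1_const)
    then show "\<psi> a = Q a + (- ?q0) * Z a"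
      using vertex_value_broken[of _ Q q a] plus(2) minus(2) vertex(2)[OF a] a Q
      by (auto simp: Z_vertex)
  qed (intro P1 P1_add P1_cmult P1_Z Q)+
  then have \<psi>_eq: "\<psi> x = Q x - ?q0 * Z x" for x by simp
  obtain C where C: "n \<bullet> C = 0"
    "\<And>i. i \<in> I \<Longrightarrow> \<mu>p * (t i \<bullet> C) = (\<mu>m - \<mu>p) * (t i \<bullet> L0 n + n \<bullet> L0 (t i) - (g \<bullet> n) * (t i \<bullet> C))"
    and lift: "\<And>x. lift_v \<phi> x = \<phi> x + (w x - W x) *\<^sub>R C"
    "\<And>x. lift_q \<phi> \<psi> x = \<psi> x + 2 * (\<mu>m - \<mu>p) * (n \<bullet> L0 n) * (z x - Z x)"
    using lift_affine[OF L0, of b0] unfolding \<phi> by metis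
  have "c = C"
  proof (rule frame_eqI)
    show "n \<bullet> c = n \<bullet> C" using nc C(1) by simp
    fix i assume i: "i \<in> I"
    let ?D = "t i \<bullet> c - t i \<bullet> C"
    \<comment> \<open>The equation for \<open>c\<close> involves \<open>L\<close>, the one for
      \<open>C\<close> involves \<open>L0\<close>, and these differ by
      \<open>(g \<bullet> u) c\<close>. Subtracting leaves a homogeneous equation whose factor is
      \<mu>p times the positive denominator.\<close>
    have "\<mu>p * ?D = - (\<mu>m - \<mu>p) * (g \<bullet> n) * ?D"
      using c[OF i] C(2)[OF i] nc by (simp add: L0_eq inner_add_right algebra_simps)
    moreover have "\<mu>p * (1 + (\<mu>m / \<mu>p - 1) * (g \<bullet> n)) = \<mu>p + (\<mu>m - \<mu>p) * (g \<bullet> n)"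
      using \<mu>p by (simp add: field_simps)
    ultimately have "\<mu>p * (1 + (\<mu>m / \<mu>p - 1) * (g \<bullet> n)) * ?D = 0"
      by (simp add: algebra_simps)
    then show "t i \<bullet> c = t i \<bullet> C"
      using denominator_pos \<mu>p by simp
  qed
  have nL: "n \<bullet> L0 n = n \<bullet> L n" by (simp add: L0_eq inner_add_right nc)
  show "v x = lift_v \<phi> x"
    using x unfolding lift \<phi>_eq \<open>c = C\<close>[symmetric]
    by (auto simp: plus(1) minus(1) w_Tp w_Tm scaleR_diff_left)
  show "q x = lift_q \<phi> \<psi> x"
    using x unfolding lift \<psi>_eq nL
    by (auto simp: plus(2) minus(2) z_Tp z_Tm algebra_simps)
qed

text \<open>Existence half. The corrections are multiples of \<open>w - W\<close> and
  \<open>z - Z\<close>, whose vertex values vanish, so those of the affine pair are kept.\<close>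

lemma lift_in_space:
  assumes P1: "\<forall>i. P1 (\<lambda>x. \<phi> x $ i)" "P1 \<psi>"
  shows "(lift_v \<phi>, lift_q \<phi> \<psi>) \<in> V"
    and "a \<in> vertices T \<Longrightarrow> vertex_value d Tp Tm (\<lambda>x. lift_v \<phi> x $ i) a = \<phi> a $ i"
    and "a \<in> vertices T \<Longrightarrow> vertex_value d Tp Tm (lift_q \<phi> \<psi>) a = \<psi> a"
proof -
  obtain b0 L0 where L0: "linear L0" and \<phi>: "\<phi> = (\<lambda>x. b0 + L0 x)"
    using P1(1) unfolding P1_vec_iff by blast
  obtain \<beta> where W: "W = (\<lambda>x. \<beta> + g \<bullet> x)" by (rule W_affine)
  obtain C where C: "n \<bullet> C = 0"
    "\<And>i. i \<in> I \<Longrightarrow> \<mu>p * (t i \<bullet> C) = (\<mu>m - \<mu>p) * (t i \<bullet> L0 n + n \<bullet> L0 (t i) - (g \<bullet> n) * (t i \<bullet> C))"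
    and lift: "\<And>x. lift_v \<phi> x = \<phi> x + (w x - W x) *\<^sub>R C"
    "\<And>x. lift_q \<phi> \<psi> x = \<psi> x + 2 * (\<mu>m - \<mu>p) * (n \<bullet> L0 n) * (z x - Z x)"
    using lift_affine[OF L0, of b0] unfolding \<phi> by metis
  let ?\<theta> = "2 * (\<mu>m - \<mu>p) * (n \<bullet> L0 n)"
  \<comment> \<open>The minus piece is the lift with \<open>w\<close> and \<open>z\<close> set to 0;
    \<open>b\<close>, \<open>L\<close> and \<open>Q\<close> are read off from it.\<close>
  define b where "b = b0 - \<beta> *\<^sub>R C"
  define L where "L = (\<lambda>u. L0 u - (g \<bullet> u) *\<^sub>R C)"
  define Q where "Q = (\<lambda>x. \<psi> x - ?\<theta> * Z x)"
  have L: "linear L"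
    unfolding L_def
    by (auto intro!: linearI simp: linear_add[OF L0] linear_scale[OF L0] inner_add_right algebra_simps)
  have Q: "P1 Q" unfolding Q_def by (intro P1_diff P1_cmult P1 P1_Z)
  have bL: "b + L x = \<phi> x - W x *\<^sub>R C" for x
    by (simp add: b_def L_def \<phi> W algebra_simps)
  have minus: "lift_v \<phi> x = b + L x" "lift_q \<phi> \<psi> x = Q x" if "x \<in> Tm" for x
    using that by (simp_all add: lift bL Q_def w_Tm z_Tm algebra_simps)
  have nL: "n \<bullet> L n = n \<bullet> L0 n"
    by (simp add: L_def inner_diff_right C(1))
  have plus: "lift_v \<phi> x = b + L x + (n \<bullet> (x - xs)) *\<^sub>R C"
    "lift_q \<phi> \<psi> x = Q x + 2 * (\<mu>p - \<mu>m) * (n \<bullet> L n)" if "x \<in> Tp" for x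
    using that by (simp_all add: lift bL nL Q_def w_Tp z_Tp algebra_simps)
  have "\<mu>p * (t i \<bullet> C) = (\<mu>m - \<mu>p) * (t i \<bullet> L n + n \<bullet> L (t i))" if "i \<in> I" for i
    using C(2)[OF that] by (simp add: L_def inner_diff_right C(1) algebra_simps)
  then show "(lift_v \<phi>, lift_q \<phi> \<psi>) \<in> V"
    unfolding ife_space_iff using L Q C(1) minus plus
    by (intro exI[of _ b] exI[of _ L] exI[of _ C] exI[of _ Q]) simp
  assume a: "a \<in> vertices T"
  have P1_L: "P1 (\<lambda>x. (b + L x) $ i)" using P1_vec_affine[OF L] by blast
  have P1_jump: "P1 (\<lambda>x. (b + L x) $ i + C $ i * (n \<bullet> (x - xs)))"
    by (intro P1_add P1_cmult P1_L P1_inner_diff)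
  have "vertex_value d Tp Tm (\<lambda>x. lift_v \<phi> x $ i) a =
      (if 0 < n \<bullet> (a - xs) then (b + L a) $ i + C $ i * (n \<bullet> (a - xs)) else (b + L a) $ i)"
    by (rule vertex_value_broken[OF P1_jump P1_L _ _ a]) (simp_all add: plus(1) minus(1) mult.commute)
  then show "vertex_value d Tp Tm (\<lambda>x. lift_v \<phi> x $ i) a = \<phi> a $ i"
    unfolding bL using a by (simp add: W_vertex max_def mult.commute)
  have P1_jump: "P1 (\<lambda>x. Q x + 2 * (\<mu>p - \<mu>m) * (n \<bullet> L n))" by (intro P1_add Q P1_const)
  have "vertex_value d Tp Tm (lift_q \<phi> \<psi>) a =
      (if 0 < n \<bullet> (a - xs) then Q a + 2 * (\<mu>p - \<mu>m) * (n \<bullet> L n) else Q a)"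
    by (rule vertex_value_broken[OF P1_jump Q _ _ a]) (simp_all add: plus(2) minus(2))
  then show "vertex_value d Tp Tm (lift_q \<phi> \<psi>) a = \<psi> a"
    using a by (simp add: Q_def Z_vertex nL algebra_simps)
qed

end

section \<open>Degrees of freedom\<close>

text \<open>Vertex values are taken from the extensions of the two parts, so values of a function
  off \<open>Tp \<union> Tm\<close> cannot influence them.\<close>

lemma vertex_value_cong:
  assumes "\<And>x. x \<in> Tp \<union> Tm \<Longrightarrow> f x = f' x"
  shows "vertex_value d Tp Tm f = vertex_value d Tp Tm f'"
  using assms by (simp add: fun_eq_iff vertex_value_def P1_ext_def)

lemma dof_cong:
  assumes "\<And>x. x \<in> Tp \<union> Tm \<Longrightarrow> v x = v' x \<and> q x = q' x"
  shows "dof e a d Tp Tm l (v, q) = dof e a d Tp Tm l (v', q')"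
proof -
  have "vertex_value d Tp Tm (\<lambda>x. v x $ i) = vertex_value d Tp Tm (\<lambda>x. v' x $ i)" for i
    by (rule vertex_value_cong) (simp add: assms)
  moreover have "vertex_value d Tp Tm q = vertex_value d Tp Tm q'"
    by (rule vertex_value_cong) (simp add: assms)
  ultimately show ?thesis by (simp add: dof_def Let_def)
qed

lemma card_dofs: "(N + 1)^2 = N * (N + 1) + (N + 1)" for N :: nat
  by (simp add: power2_eq_square algebra_simps)

text \<open>The index \<open>l\<close> runs through all pairs of a component and a vertex, and then
  through the vertices for the pressure. Comparing degrees of freedom thus amounts to comparing
  vertex values.\<close>

lemma dof_eq_iff:
  fixes a :: "nat \<Rightarrow> real^'n" and e :: "nat \<Rightarrow> 'n"
  assumes a: "bij_betw a {1..CARD('n) + 1} A" and e: "bij_betw e {1..CARD('n)} UNIV"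
  shows "(\<forall>l\<in>{1..(CARD('n) + 1)^2}. dof e a d Tp Tm l (v, q) = dof e a d Tp Tm l (v', q')) \<longleftrightarrow>
    (\<forall>x\<in>A. (\<forall>i. vertex_value d Tp Tm (\<lambda>y. v y $ i) x = vertex_value d Tp Tm (\<lambda>y. v' y $ i) x) \<and>
      vertex_value d Tp Tm q x = vertex_value d Tp Tm q' x)" (is "?D \<longleftrightarrow> ?V")
proof
  let ?N = "CARD('n)"
  assume D: ?D
  show ?V
  proof (intro ballI conjI allI)
    fix x assume "x \<in> A"
    then have "x \<in> a ` {1..?N + 1}" using a by (simp add: bij_betw_def)
    then obtain j where j: "1 \<le> j" "j \<le> ?N + 1" "x = a j" by auto
    let ?l = "?N * (?N + 1) + j"
    have "?l \<in> {1..(?N + 1)^2}" using j(1,2) by (simp only: card_dofs atLeastAtMost_iff) simp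
    from D[rule_format, OF this] show "vertex_value d Tp Tm q x = vertex_value d Tp Tm q' x"
      using j by (simp add: dof_def Let_def)
    fix i
    have "i \<in> e ` {1..?N}" using e by (simp add: bij_betw_def)
    then obtain i' where i': "1 \<le> i'" "i' \<le> ?N" "i = e i'" by auto
    \<comment> \<open>After removing the final 1, quotient and remainder by \<open>N + 1\<close> are
      \<open>i' - 1\<close> and \<open>j - 1\<close>.\<close>
    let ?l = "(j - 1) + (i' - 1) * (?N + 1) + 1"
    have "(i' - 1) * (?N + 1) \<le> (?N - 1) * (?N + 1)" using i' by (intro mult_right_mono) auto
    moreover have "?N * (?N + 1) = (?N - 1) * (?N + 1) + (?N + 1)"
      using i' by (cases ?N) auto
    ultimately have l: "?l \<le> ?N * (?N + 1)" using j by linarith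
    then have "?l \<in> {1..(?N + 1)^2}" by (simp only: card_dofs atLeastAtMost_iff) simp
    from D[rule_format, OF this] l
    have "vertex_value d Tp Tm (\<lambda>y. v y $ e ((?l - 1) div (?N + 1) + 1)) (a ((?l - 1) mod (?N + 1) + 1)) =
      vertex_value d Tp Tm (\<lambda>y. v' y $ e ((?l - 1) div (?N + 1) + 1)) (a ((?l - 1) mod (?N + 1) + 1))"
      unfolding dof_def Let_def by (simp only: prod.case if_True)
    moreover have "(?l - 1) div (?N + 1) + 1 = i'" "(?l - 1) mod (?N + 1) + 1 = j"
      using i' j by (simp_all only: diff_add_inverse2 div_mult_self1 mod_mult_self1) simp_all
    ultimately show "vertex_value d Tp Tm (\<lambda>y. v y $ i) x = vertex_value d Tp Tm (\<lambda>y. v' y $ i) x"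
      using i' j by simp
  qed
next
  let ?N = "CARD('n)"
  assume V: ?V
  have aA: "a j \<in> A" if "1 \<le> j" "j \<le> ?N + 1" for j
    using a that by (auto simp: bij_betw_def)
  show ?D
  proof
    fix l assume l: "l \<in> {1..(?N + 1)^2}"
    have "a ((l - 1) mod (?N + 1) + 1) \<in> A"
      using mod_less_divisor[of "?N + 1" "l - 1"] by (intro aA) linarith+
    moreover have "a (l - ?N * (?N + 1)) \<in> A" if "\<not> l \<le> ?N * (?N + 1)"
      using l that unfolding card_dofs by (intro aA) auto
    ultimately show "dof e a d Tp Tm l (v, q) = dof e a d Tp Tm l (v', q')"
      using V by (simp add: dof_def Let_def)
  qed
qed

text \<open>The stress is built from the Jacobian, whose linearity in the field relies on
  derivatives existing; affinity provides them.\<close>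

lemma inner_stress_sum:
  fixes \<phi> :: "nat \<Rightarrow> real^'n \<Rightarrow> real^'n"
  assumes "\<And>k. k \<in> K \<Longrightarrow> \<forall>i. P1 (\<lambda>x. \<phi> k x $ i)"
  shows "y \<bullet> (stress \<mu> (\<lambda>x. \<Sum>k\<in>K. \<alpha> k *\<^sub>R \<phi> k x) (\<lambda>_. 0) x *v u) =
    (\<Sum>k\<in>K. \<alpha> k * (y \<bullet> (stress \<mu> (\<phi> k) (\<lambda>_. 0) x *v u)))"
proof -
  have "\<forall>k. \<exists>L. k \<in> K \<longrightarrow> (\<phi> k has_derivative L) (at x)"
    using assms has_derivative_affine unfolding P1_vec_iff by metis
  then obtain L where L: "\<And>k. k \<in> K \<Longrightarrow> (\<phi> k has_derivative L k) (at x)"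
    by metis
  then have der: "((\<lambda>x. \<Sum>k\<in>K. \<alpha> k *\<^sub>R \<phi> k x) has_derivative (\<lambda>h. \<Sum>k\<in>K. \<alpha> k *\<^sub>R L k h)) (at x)"
    by (intro has_derivative_sum has_derivative_scaleR_right)
  show ?thesis
    unfolding inner_stress[OF der]
    by (simp add: inner_stress[OF L] inner_sum_right sum_distrib_left sum.distrib algebra_simps
        cong: sum.cong)
qed

section \<open>The standard nodal basis and its lift\<close>

locale nodal_cut_element = cut_element T Tp Tm \<Gamma>hT d w z n xs t I \<mu>p \<mu>m
  for T Tp Tm \<Gamma>hT :: "(real^'n) set" and d w z :: "real^'n \<Rightarrow> real"
    and n xs :: "real^'n" and t :: "nat \<Rightarrow> real^'n" and I :: "nat set" and \<mu>p \<mu>m :: real +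
  fixes a :: "nat \<Rightarrow> real^'n" and e :: "nat \<Rightarrow> 'n"
    and \<phi> :: "nat \<Rightarrow> real^'n \<Rightarrow> real^'n" and \<psi> :: "nat \<Rightarrow> real^'n \<Rightarrow> real" and K :: "nat set"
  assumes K: "K = {1..(CARD('n) + 1)^2}"
    and a: "bij_betw a {1..CARD('n) + 1} (vertices T)"
    and e: "bij_betw e {1..CARD('n)} UNIV"
    and P1_\<phi>: "\<And>k i. k \<in> K \<Longrightarrow> P1 (\<lambda>x. \<phi> k x $ i)"
    and P1_\<psi>: "\<And>k. k \<in> K \<Longrightarrow> P1 (\<psi> k)"
    and dual: "\<And>k l. k \<in> K \<Longrightarrow> l \<in> K \<Longrightarrow> dof e a d Tp Tm l (\<phi> k, \<psi> k) = (if k = l then 1 else 0)"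
begin

abbreviation "D \<equiv> dof e a d Tp Tm"

lemma dof_P1_eqD:
  assumes "\<And>l. l \<in> K \<Longrightarrow> D l (v, q) = D l (v', q')"
    "\<forall>i. P1 (\<lambda>x. v' x $ i)" "P1 q'" "x \<in> vertices T"
  shows "vertex_value d Tp Tm (\<lambda>x. v x $ i) x = v' x $ i" "vertex_value d Tp Tm q x = q' x"
  using dof_eq_iff[OF a e, of d Tp Tm v q v' q'] assms vertex_value_P1 by (simp_all add: K)

lemma dof_P1:
  assumes "\<And>i. P1 (\<lambda>x. v x $ i)" "P1 q" "l \<in> K"
  shows "D l (v, q) = (let N = CARD('n) in
     if l \<le> N * (N + 1) then v (a ((l - 1) mod (N + 1) + 1)) $ e ((l - 1) div (N + 1) + 1)
     else q (a (l - N * (N + 1))))"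
proof -
  let ?N = "CARD('n)"
  have aA: "a j \<in> vertices T" if "1 \<le> j" "j \<le> ?N + 1" for j
    using a that by (auto simp: bij_betw_def)
  have "a ((l - 1) mod (?N + 1) + 1) \<in> vertices T"
    using mod_less_divisor[of "?N + 1" "l - 1"] by (intro aA) linarith+
  moreover have "a (l - ?N * (?N + 1)) \<in> vertices T" if "\<not> l \<le> ?N * (?N + 1)"
    using assms(3) that unfolding K card_dofs by (intro aA) auto
  ultimately show ?thesis
    using vertex_value_P1[OF assms(1)] vertex_value_P1[OF assms(2)]
    by (simp add: dof_def Let_def)
qed

lemma P1_eq_of_dof:
  assumes "\<And>l. l \<in> K \<Longrightarrow> D l (v, q) = D l (v', q')"
    "\<And>i. P1 (\<lambda>x. v x $ i)" "P1 q" "\<And>i. P1 (\<lambda>x. v' x $ i)" "P1 q'"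
  shows "v = v'" "q = q'"
proof -
  have "(\<lambda>x. v x $ i) = (\<lambda>x. v' x $ i)" for i
    using dof_P1_eqD(1)[OF assms(1)] assms vertex_value_P1[OF assms(2)]
    by (intro P1_eq_on_vertices assms) auto
  then show "v = v'" by (simp add: fun_eq_iff vec_eq_iff)
  show "q = q'"
    using dof_P1_eqD(2)[OF assms(1)] assms vertex_value_P1[OF assms(3)]
    by (intro P1_eq_on_vertices assms) auto
qed

text \<open>Duality makes all degrees of freedom of the other member of the pair vanish, so
  replacing that member by zero changes no degree of freedom, and an affine pair is determined by
  these.\<close>

lemma standard_basis_zero:
  assumes k: "k \<in> K"
  shows "k \<le> CARD('n) * (CARD('n) + 1) \<Longrightarrow> \<psi> k = (\<lambda>_. 0)"
    and "\<not> k \<le> CARD('n) * (CARD('n) + 1) \<Longrightarrow> \<phi> k = (\<lambda>_. 0)"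
proof -
  assume "k \<le> CARD('n) * (CARD('n) + 1)"
  then have "D l (\<phi> k, \<psi> k) = D l (\<phi> k, \<lambda>_. 0)" if "l \<in> K" for l
    using dual[OF k that] that
    by (auto simp: dof_P1[OF P1_\<phi>[OF k] P1_const that] dof_P1[OF P1_\<phi>[OF k] P1_\<psi>[OF k] that] Let_def
        split: if_splits)
  then show "\<psi> k = (\<lambda>_. 0)"
    using P1_eq_of_dof(2)[of "\<phi> k" "\<psi> k" "\<phi> k" "\<lambda>_. 0"] P1_\<phi>[OF k] P1_\<psi>[OF k] P1_const by blast
next
  have P1_0: "P1 (\<lambda>x. (0::real^'n) $ i)" for i by simp
  assume "\<not> k \<le> CARD('n) * (CARD('n) + 1)"
  then have "D l (\<phi> k, \<psi> k) = D l (\<lambda>_. 0, \<psi> k)" if "l \<in> K" for l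
    using dual[OF k that] that
    by (auto simp: dof_P1[OF P1_0 P1_\<psi>[OF k] that] dof_P1[OF P1_\<phi>[OF k] P1_\<psi>[OF k] that] Let_def
        split: if_splits)
  then show "\<phi> k = (\<lambda>_. 0)"
    using P1_eq_of_dof(1)[of "\<phi> k" "\<psi> k" "\<lambda>_. 0" "\<psi> k"] P1_\<phi>[OF k] P1_\<psi>[OF k] P1_0 by blast
qed

lemma dof_sum:
  assumes "l \<in> K"
  shows "D l (\<lambda>x. \<Sum>k\<in>K. \<alpha> k *\<^sub>R \<phi> k x, \<lambda>x. \<Sum>k\<in>K. \<alpha> k * \<psi> k x) = \<alpha> l"
proof -
  have fin: "finite K" by (simp add: K)
  have P1: "P1 (\<lambda>x. (\<Sum>k\<in>K. \<alpha> k *\<^sub>R \<phi> k x) $ i)" "P1 (\<lambda>x. \<Sum>k\<in>K. \<alpha> k * \<psi> k x)" for i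
    using P1_sum[of K "\<lambda>k x. \<phi> k x $ i" \<alpha>] P1_sum[of K \<psi> \<alpha>] P1_\<phi> P1_\<psi>
    by (simp_all add: sum_component)
  have "D l (\<lambda>x. \<Sum>k\<in>K. \<alpha> k *\<^sub>R \<phi> k x, \<lambda>x. \<Sum>k\<in>K. \<alpha> k * \<psi> k x) = (\<Sum>k\<in>K. \<alpha> k * D l (\<phi> k, \<psi> k))"
    unfolding dof_P1[OF P1 assms]
    by (simp add: dof_P1[OF P1_\<phi> P1_\<psi> assms] Let_def sum_component cong: sum.cong)
  also have "\<dots> = (\<Sum>k\<in>K. if l = k then \<alpha> k else 0)"
    by (rule sum.cong) (auto simp: dual assms)
  also have "\<dots> = \<alpha> l" using assms fin by simp
  finally show ?thesis .
qed

text \<open>\<open>W\<close>, \<open>Z\<close> and the denominator do not depend on the pair, and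
  the stress is linear in it. An expansion in the standard basis therefore lifts term by
  term.\<close>

lemma lift_sum:
  "lift_v (\<lambda>x. \<Sum>k\<in>K. \<alpha> k *\<^sub>R \<phi> k x) x = (\<Sum>k\<in>K. \<alpha> k *\<^sub>R lift_v (\<phi> k) x)"
  "lift_q (\<lambda>x. \<Sum>k\<in>K. \<alpha> k *\<^sub>R \<phi> k x) (\<lambda>x. \<Sum>k\<in>K. \<alpha> k * \<psi> k x) x = (\<Sum>k\<in>K. \<alpha> k * lift_q (\<phi> k) (\<psi> k) x)"
proof -
  have stress_sum: "y \<bullet> (stress \<mu> (\<lambda>x. \<Sum>k\<in>K. \<alpha> k *\<^sub>R \<phi> k x) (\<lambda>_. 0) x *v u) =
    (\<Sum>k\<in>K. \<alpha> k * (y \<bullet> (stress \<mu> (\<phi> k) (\<lambda>_. 0) x *v u)))" for y u \<mu>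
    by (rule inner_stress_sum) (simp add: P1_\<phi>)
  show "lift_q (\<lambda>x. \<Sum>k\<in>K. \<alpha> k *\<^sub>R \<phi> k x) (\<lambda>x. \<Sum>k\<in>K. \<alpha> k * \<psi> k x) x = (\<Sum>k\<in>K. \<alpha> k * lift_q (\<phi> k) (\<psi> k) x)"
    by (simp add: lift_q_def stress_sum sum_distrib_right sum.distrib distrib_left mult.assoc)
  have coeff: "(\<Sum>k\<in>K. \<alpha> k * s k) / c * r = (\<Sum>k\<in>K. \<alpha> k * (s k / c * r))" for s and c r :: real
    by (simp add: sum_divide_distrib sum_distrib_right mult.assoc)
  show "lift_v (\<lambda>x. \<Sum>k\<in>K. \<alpha> k *\<^sub>R \<phi> k x) x = (\<Sum>k\<in>K. \<alpha> k *\<^sub>R lift_v (\<phi> k) x)"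
    unfolding lift_v_def stress_sum coeff
    by (simp add: scaleR_add_right sum.distrib scaleR_sum_left scaleR_sum_right)
      (rule sum.swap)
qed

lemma space_eq_lift:
  assumes V: "(v, q) \<in> V" and P1: "\<forall>i. P1 (\<lambda>x. v' x $ i)" "P1 q'"
    and dof: "\<And>l. l \<in> K \<Longrightarrow> D l (v, q) = D l (v', q')" and x: "x \<in> Tp \<union> Tm"
  shows "v x = lift_v v' x" "q x = lift_q v' q' x"
  using lift_unique[OF V P1 dof_P1_eqD[OF dof P1] x] by simp_all

text \<open>Duality gives \<open>\<Phi> k\<close> and \<open>\<Psi> k\<close> the vertex values of
  the standard pair, so uniqueness makes them its lift. Conversely lifts inherit duality, and a
  member of the space is the lift of its affine nodal interpolant, whose expansion supplies the
  required coefficients.\<close>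

lemma dual_basis_iff_lift:
  "dual_basis V (Tp \<union> Tm) D \<Phi> \<Psi> \<longleftrightarrow>
    (\<forall>k\<in>K. \<forall>x\<in>Tp \<union> Tm. \<Phi> k x = lift_v (\<phi> k) x \<and> \<Psi> k x = lift_q (\<phi> k) (\<psi> k) x)"
proof
  assume B: "dual_basis V (Tp \<union> Tm) D \<Phi> \<Psi>"
  show "\<forall>k\<in>K. \<forall>x\<in>Tp \<union> Tm. \<Phi> k x = lift_v (\<phi> k) x \<and> \<Psi> k x = lift_q (\<phi> k) (\<psi> k) x"
  proof (intro ballI)
    fix k x assume k: "k \<in> K" and x: "x \<in> Tp \<union> Tm"
    have "(\<Phi> k, \<Psi> k) \<in> V" "\<And>l. l \<in> K \<Longrightarrow> D l (\<Phi> k, \<Psi> k) = D l (\<phi> k, \<psi> k)"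
      using B k dual unfolding dual_basis_def K[symmetric] by simp_all
    then show "\<Phi> k x = lift_v (\<phi> k) x \<and> \<Psi> k x = lift_q (\<phi> k) (\<psi> k) x"
      using space_eq_lift[OF _ _ P1_\<psi>[OF k] _ x] P1_\<phi>[OF k] by blast
  qed
next
  assume eq: "\<forall>k\<in>K. \<forall>x\<in>Tp \<union> Tm. \<Phi> k x = lift_v (\<phi> k) x \<and> \<Psi> k x = lift_q (\<phi> k) (\<psi> k) x"
  show "dual_basis V (Tp \<union> Tm) D \<Phi> \<Psi>"
    unfolding dual_basis_def K[symmetric]
  proof (intro conjI ballI)
    fix k assume k: "k \<in> K"
    have P1: "\<forall>i. P1 (\<lambda>x. \<phi> k x $ i)" "P1 (\<psi> k)" using P1_\<phi> P1_\<psi> k by blast+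
    show "(\<Phi> k, \<Psi> k) \<in> V"
      using lift_in_space(1)[OF P1] eq k unfolding ife_space_iff by simp
    fix l assume l: "l \<in> K"
    have "D l (\<Phi> k, \<Psi> k) = D l (lift_v (\<phi> k), lift_q (\<phi> k) (\<psi> k))"
      by (rule dof_cong) (use eq k in blast)
    also have "\<dots> = D l (\<phi> k, \<psi> k)"
      using dof_eq_iff[OF a e, of d Tp Tm "lift_v (\<phi> k)" "lift_q (\<phi> k) (\<psi> k)" "\<phi> k" "\<psi> k"] l
        lift_in_space(2,3)[OF P1] vertex_value_P1 P1 by (simp add: K)
    finally show "D l (\<Phi> k, \<Psi> k) = (if k = l then 1 else 0)"
      using dual[OF k l] by simp
  next
    fix vq assume "vq \<in> V"
    then obtain v q where vq: "vq = (v, q)" and V: "(v, q) \<in> V" by (cases vq) auto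
    \<comment> \<open>\<open>v'\<close> and \<open>q'\<close> form the affine pair with the degrees
      of freedom of \<open>(v, q)\<close>, written in the standard basis.\<close>
    define v' where "v' = (\<lambda>x. \<Sum>k\<in>K. D k (v, q) *\<^sub>R \<phi> k x)"
    define q' where "q' = (\<lambda>x. \<Sum>k\<in>K. D k (v, q) * \<psi> k x)"
    have P1: "\<forall>i. P1 (\<lambda>x. v' x $ i)" "P1 q'"
      unfolding v'_def q'_def
      using P1_sum[of K "\<lambda>k x. \<phi> k x $ _"] P1_sum[of K \<psi>] P1_\<phi> P1_\<psi> by (simp_all add: sum_component)
    have dof: "D l (v, q) = D l (v', q')" if "l \<in> K" for l
      using dof_sum[OF that, of "\<lambda>k. D k (v, q)"] by (simp add: v'_def q'_def)
    have "v x = (\<Sum>k\<in>K. D k (v, q) *\<^sub>R \<Phi> k x) \<and> q x = (\<Sum>k\<in>K. D k (v, q) * \<Psi> k x)"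
      if x: "x \<in> Tp \<union> Tm" for x
    proof -
      have "v x = (\<Sum>k\<in>K. D k (v, q) *\<^sub>R lift_v (\<phi> k) x)"
        using space_eq_lift(1)[OF V P1 dof x] unfolding v'_def lift_sum .
      moreover have "q x = (\<Sum>k\<in>K. D k (v, q) * lift_q (\<phi> k) (\<psi> k) x)"
        using space_eq_lift(2)[OF V P1 dof x] unfolding v'_def q'_def lift_sum .
      ultimately show ?thesis using eq x by (simp cong: sum.cong)
    qed
    then show "case vq of (v, q) \<Rightarrow> \<forall>x\<in>Tp \<union> Tm. v x = (\<Sum>k\<in>K. D k (v, q) *\<^sub>R \<Phi> k x) \<and>
                         q x = (\<Sum>k\<in>K. D k (v, q) * \<Psi> k x)"
      by (simp add: vq)
  qed
qed

lemma lift_standard_basis: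
  assumes "k \<in> K"
  shows "lift_v (\<phi> k) x = (if k \<le> CARD('n) * (CARD('n) + 1)
          then \<phi> k x + (\<Sum>i\<in>I.
             ((t i \<bullet> (stress (\<mu>m / \<mu>p - 1) (\<phi> k) (\<lambda>_. 0) x *v n))
               / (1 + (\<mu>m / \<mu>p - 1) * (grad W x \<bullet> n))
               * (w x - W x)) *\<^sub>R t i)
          else 0)"
    and "lift_q (\<phi> k) (\<psi> k) x = (if k \<le> CARD('n) * (CARD('n) + 1)
          then (n \<bullet> (stress (\<mu>m - \<mu>p) (\<phi> k) (\<lambda>_. 0) x *v n)) * (z x - Z x)
          else \<psi> k x)"
proof -
  have "y \<bullet> (stress \<mu> (\<lambda>_. 0) (\<lambda>_. 0) x *v n) = 0" for y \<mu>
    by (simp add: inner_stress[OF has_derivative_const])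
  then show "lift_v (\<phi> k) x = (if k \<le> CARD('n) * (CARD('n) + 1)
          then \<phi> k x + (\<Sum>i\<in>I.
             ((t i \<bullet> (stress (\<mu>m / \<mu>p - 1) (\<phi> k) (\<lambda>_. 0) x *v n))
               / (1 + (\<mu>m / \<mu>p - 1) * (grad W x \<bullet> n))
               * (w x - W x)) *\<^sub>R t i)
          else 0)"
    and "lift_q (\<phi> k) (\<psi> k) x = (if k \<le> CARD('n) * (CARD('n) + 1)
          then (n \<bullet> (stress (\<mu>m - \<mu>p) (\<phi> k) (\<lambda>_. 0) x *v n)) * (z x - Z x)
          else \<psi> k x)"
    using standard_basis_zero[OF assms] unfolding lift_v_def lift_q_def by simp_all
qed

end

section \<open>Reduction of the mesh setting to one cut element\<close>

theorem mainTheorem6: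
  fixes lo hi :: "real^'n"
    and \<Omega> \<Gamma> \<Omega>m \<Omega>p T Tp Tm \<Gamma>hT H :: "(real^'n) set"
    and F :: "(real^'n) set set set" and M :: "(real^'n) set set"
    and d z w :: "real^'n \<Rightarrow> real"
    and h0 \<mu>p \<mu>m :: real
    and n xs :: "real^'n" and t a :: "nat \<Rightarrow> real^'n"
    and e :: "nat \<Rightarrow> 'n"
    and \<phi> :: "nat \<Rightarrow> real^'n \<Rightarrow> real^'n" and \<psi> :: "nat \<Rightarrow> real^'n \<Rightarrow> real"
    and \<Phi> :: "nat \<Rightarrow> real^'n \<Rightarrow> real^'n" and \<Psi> :: "nat \<Rightarrow> real^'n \<Rightarrow> real"
  assumes dim: "CARD('n) = 2 \<or> CARD('n) = 3"
    and domain: "\<forall>i. lo $ i < hi $ i" "\<Omega> = box lo hi"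
    and interface: "closed_C2_hypersurface \<Gamma>" "interface_divides \<Omega> \<Gamma> \<Omega>m \<Omega>p"
    and d: "d = signed_dist \<Gamma> \<Omega>m"
    and mu: "\<mu>p > 0" "\<mu>m > 0"
    and family: "\<forall>M'\<in>F. cartesian_mesh lo hi M'" "shape_regular F"
    and threshold: "h0 > 0" "\<forall>M'\<in>F. mesh_size M' < h0 \<longrightarrow> interface_resolved \<Omega> \<Gamma> d M'"
    and mesh: "M \<in> F" "mesh_size M < h0"
    and T: "T \<in> interface_elements M \<Gamma>"
    and T_parts: "Tp = T \<inter> Omega_h_plus \<Omega> M d" "Tm = T \<inter> Omega_h_minus \<Omega> M d"
    and interface_T: "\<Gamma>hT = Gamma_h \<Omega> M d \<inter> T" "\<Gamma>hT \<noteq> {}"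
    and H: "hyperplane H" "\<Gamma>hT \<subseteq> H"
    and frame: "interface_frame H Tp Tm n t"
    and xs: "xs \<in> \<Gamma>hT"
    and vertex_enum: "bij_betw a {1..CARD('n) + 1} (vertices T)"
    and coord_enum: "bij_betw e {1..CARD('n)} UNIV"
    and z: "\<forall>x\<in>Tp. z x = -1" "\<forall>x\<in>Tm. z x = 0"
    and w: "\<forall>x\<in>Tp. w x = infdist x H" "\<forall>x\<in>Tm. w x = 0"
    and standard_basis:
      "\<forall>k\<in>{1..(CARD('n) + 1)^2}. (\<forall>i. P1 (\<lambda>x. \<phi> k x $ i)) \<and> P1 (\<psi> k)"
      "\<forall>k\<in>{1..(CARD('n) + 1)^2}. \<forall>l\<in>{1..(CARD('n) + 1)^2}.
         dof e a d Tp Tm l (\<phi> k, \<psi> k) = (if k = l then 1 else 0)"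
  shows "dual_basis (ife_space \<mu>p \<mu>m Tp Tm \<Gamma>hT xs n) (Tp \<union> Tm) (dof e a d Tp Tm) \<Phi> \<Psi> \<longleftrightarrow>
    (\<forall>k\<in>{1..(CARD('n) + 1)^2}. \<forall>x\<in>Tp \<union> Tm.
       \<Phi> k x =
         (if k \<le> CARD('n) * (CARD('n) + 1)
          then \<phi> k x + (\<Sum>i=1..CARD('n) - 1.
             ((t i \<bullet> (stress (\<mu>m / \<mu>p - 1) (\<phi> k) (\<lambda>_. 0) x *v n))
               / (1 + (\<mu>m / \<mu>p - 1) * (grad (broken_interp d Tp Tm T w) x \<bullet> n))
               * (w x - broken_interp d Tp Tm T w x)) *\<^sub>R t i)
          else 0) \<and>
       \<Psi> k x =
         (if k \<le> CARD('n) * (CARD('n) + 1)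
          then (n \<bullet> (stress (\<mu>m - \<mu>p) (\<phi> k) (\<lambda>_. 0) x *v n)) * (z x - broken_interp d Tp Tm T z x)
          else \<psi> k x))"
proof -
  have M_mesh: "cartesian_mesh lo hi M" and TM: "T \<in> M" and "T \<noteq> {}"
    using family(1) mesh(1) T by (auto simp: interface_elements_def)
  have card: "card (vertices T) = CARD('n) + 1"
    using bij_betw_same_card[OF vertex_enum] by simp
  note T_facts = mesh_vertices[OF M_mesh TM \<open>T \<noteq> {}\<close> card]
  have T_sub: "T \<subseteq> \<Omega>" using mesh_subset_box[OF M_mesh TM] domain(2) by simp
  define L where "L = P1_interp T d"
  obtain L' where "P1 L'" "\<forall>a\<in>vertices T. L' a = d a" using T_facts(3) by blast
  then have L: "P1 L" "\<And>a. a \<in> vertices T \<Longrightarrow> L a = d a"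
    using P1_interp_eq[OF T_facts(2), of L' d] by (auto simp: L_def)
  \<comment> \<open>Inside \<open>T\<close> the mesh interpolant is the local interpolant
    \<open>L\<close>, so the parts of \<open>T\<close> become sign sets of one affine
    function.\<close>
  have parts: "Tp = {x\<in>T. 0 < L x}" "Tm = {x\<in>T. L x < 0}" "\<Gamma>hT = {x\<in>T. L x = 0}"
    using T_sub mesh_interp_eq[OF M_mesh TM]
    by (auto simp: T_parts interface_T(1) Omega_h_plus_def Omega_h_minus_def Gamma_h_def L_def)
  have xs_H: "xs \<in> H" "xs \<in> T" "L xs = 0" using xs H(2) by (auto simp: parts)
  have n: "norm n = 1" "\<forall>x\<in>H. \<forall>y\<in>H. n \<bullet> (x - y) = 0"
    and sides: "\<And>x. x \<in> Tp \<Longrightarrow> 0 < n \<bullet> (x - xs)" "\<And>x. x \<in> Tm \<Longrightarrow> n \<bullet> (x - xs) < 0"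
    and t: "\<And>i. i \<in> {1..CARD('n) - 1} \<Longrightarrow> t i \<bullet> n = 0"
      "\<And>i j. i \<in> {1..CARD('n) - 1} \<Longrightarrow> j \<in> {1..CARD('n) - 1} \<Longrightarrow> t i \<bullet> t j = (if i = j then 1 else 0)"
    using frame xs_H(1) unfolding interface_frame_def by blast+
  have on_H: "n \<bullet> (x - xs) = 0" if "x \<in> \<Gamma>hT" for x
    using that H(2) n(2) xs_H(1) by blast
  \<comment> \<open>The frame and \<open>on_H\<close> give one implication for each sign of
    \<open>L x\<close>. The three signs are exhaustive and the three conclusions exclude each other,
    so the implications reverse.\<close>
  have sgn: "0 < L x \<longleftrightarrow> 0 < n \<bullet> (x - xs)" "L x < 0 \<longleftrightarrow> n \<bullet> (x - xs) < 0" "L x = 0 \<longleftrightarrow> n \<bullet> (x - xs) = 0"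
    if "x \<in> T" for x
    using linorder_less_linear[of "L x" 0] that sides[of x] on_H[of x] unfolding parts by auto
  \<comment> \<open>Signs are known on the open element only; \<open>P1_same_sign\<close> extends
    them to the vertices, where \<open>L\<close> equals \<open>d\<close>.\<close>
  have d_pos: "0 < d a \<longleftrightarrow> 0 < n \<bullet> (a - xs)" if "a \<in> vertices T" for a
    using P1_same_sign[OF L(1) T_facts(1) xs_H(2,3) sgn(1)] L(2)[OF that] by metis
  interpret nodal_cut_element T Tp Tm \<Gamma>hT d w z n xs t "{1..CARD('n) - 1}" \<mu>p \<mu>m a e \<phi> \<psi> "{1..(CARD('n) + 1)^2}"
  proof unfold_locales
    show "Tp = {x \<in> T. 0 < n \<bullet> (x - xs)}" "Tm = {x \<in> T. n \<bullet> (x - xs) < 0}"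
      "\<Gamma>hT = {x \<in> T. n \<bullet> (x - xs) = 0}"
      unfolding parts using sgn by blast+
    show "w x = n \<bullet> (x - xs)" if "x \<in> Tp" for x
      using w(1) infdist_hyperplane(2)[OF H(1) xs_H(1) n] sides(1)[OF that] that by simp
    show "0 \<le> g \<bullet> n \<and> g \<bullet> n \<le> 1" if "\<forall>a\<in>vertices T. b + g \<bullet> a = max 0 (n \<bullet> (a - xs))" for b g
      using T_facts(4)[OF n(1) that] .
  qed (use T_facts xs_H n t d_pos mu z w(2) vertex_enum coord_enum standard_basis in auto)
  show ?thesis
    unfolding dual_basis_iff_lift by (intro ball_cong refl) (simp only: lift_standard_basis)
qed

end
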